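(* Let $d_S=\log9/\log5$. There is a constant $c>1$ such that for every $\lambda_0\in(0,6)$, every $\mathbf a\in\mathbb R^3\setminus\{\mathbf0\}$, every $n\ge1$ and every $\varepsilon=\varepsilon_1\cdots\varepsilon_n\in\{-1,1\}^n$ with $\varepsilon_n=1$, the eigenfunction $u^\varepsilon$ on $\mathcal{SG}$ associated with $(\lambda_0,\mathbf a,\varepsilon)$, with eigenvalue $\lambda^\varepsilon$, satisfies $$c^{-1}(\lambda^\varepsilon)^{d_S/2}\le\#\mathrm{Extr}(u^\varepsilon)\le c(\lambda^\varepsilon)^{d_S/2}.$$
   Context: Sierpinski gasket: $S=\{1,2,3\}$; $p_1,p_2,p_3$ are the vertices of an equilateral triangle in $\mathbb R^2$, $V_0=\{p_1,p_2,p_3\}$; $F_i(x)=(x-p_i)/2+p_i$; $\mathcal{SG}$ is the unique nonempty compact set with $\mathcal{SG}=\bigcup_{i\in S}F_i\mathcal{SG}$; $p_{ij}=F_ip_j=F_jp_i$. For $w=w_1\cdots w_m\in W_m=S^m$, $F_w=F_{w_1}\circ\cdots\circ F_{w_m}$ ($W_0=\{\varnothing\}$, $F_\varnothing=\mathrm{id}$), $p_i^w=F_wp_i$, $p_{ij}^w=F_wp_{ij}$; $V_m=\bigcup_{w\in W_m}F_wV_0$. For $p\ne q\in V_m$ write $p\sim_m q$ if $p,q\in F_wV_0$ for some $w\in W_m$, and $(\Delta_m u)(p)=\sum_{q\sim_m p}(u(q)-u(p))$. $\mathscr D$ is the set of $u\in C(\mathcal{SG})$ for which there is $f\in C(\mathcal{SG})$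 with $\lim_m\max_{p\in V_m\setminus V_0}|\tfrac32 5^m(\Delta_m u)(p)-f(p)|=0$; then $\Delta u=f$. $E(\lambda)=\{u\in\mathscr D:-\Delta u=\lambda u\text{ on }\mathcal{SG}\setminus V_0\}$. Extreme sets: a nonempty $A\subset\mathcal{SG}$ is an extreme set of $u\in\mathscr D$ if for some $c\in\mathbb R$: $A$ is a connected component of $u^{-1}(c)$; $A\cap V_0=\emptyset$; and there is $\delta>0$ such that either $u\le c$ on the whole $\delta$-neighborhood $A_\delta$ of $A$ in $\mathcal{SG}$, or $u\ge c$ on all of $A_\delta$. $\mathrm{Extr}(u)$ is the set of extreme sets. Functions: $\varphi_{\pm1}(x)=\frac12(5\pm\sqrt{25-4x})$ on $(-\infty,25/4]$; $\psi(x)=\frac32\lim_{m\to\infty}5^m\varphi_{-1}^m(x)$ ($m$-fold iterate); $\varphi_\varepsilon=\varphi_{\varepsilon_n}\circ\cdots\circ\varphi_{\varepsilon_1}$. The eigenfunction $u^\varepsilon$: given $\lambda_0\in(0,6)$, $\mathbf a\in\mathbb R^3\setminus\{\mathbf0\}$, $\varepsilon\in\{-1,1\}^n$ with $\varepsilon_n=1$, set $\lambda^\varepsilon_0=\lambda_0$, $\lambda^\varepsilon_{m+1}=\varphi_{\varepsilon_{m+1}}(\lambda^\varepsilon_m)$ for $0\le m<n$, $\lambda^\varepsilon_{m+1}=\varphi_{-1}(\lambda^\varepsilon_m)$ for $m\ge n$. $u^\varepsilon$ is the continuous function on $\mathcal{SG}$ with $u^\varepsilon|_{V_0}=\mathbf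 a$ (i.e. $u^\varepsilon(p_i)=a_i$) and $$u^\varepsilon(p^w_{ij})=\frac{(4-\lambda^\varepsilon_{m+1})(u^\varepsilon(p^w_i)+u^\varepsilon(p^w_j))+2u^\varepsilon(p^w_k)}{(2-\lambda^\varepsilon_{m+1})(5-\lambda^\varepsilon_{m+1})}$$ for all $m\ge0$, $w\in W_m$ and distinct $i,j,k\in S$. By spectral decimation $u^\varepsilon\in E(\lambda^\varepsilon)$ with $\lambda^\varepsilon=5^n\psi(\varphi_\varepsilon(\lambda_0))$. *)

theory Defs
  imports "HOL-Analysis.Analysis"
begin

text \<open>The index set \<open>S = {1,2,3}\<close> is the three-element type \<open>3\<close> (in which the
  numeral \<open>3\<close> equals \<open>0\<close>), and words over \<open>S\<close> are lists over that type.\<close>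

definition equilateral :: "(3 \<Rightarrow> real^2) \<Rightarrow> bool" where
  "equilateral p \<longleftrightarrow> (\<exists>s>0. \<forall>i j. i \<noteq> j \<longrightarrow> dist (p i) (p j) = s)"

definition F :: "(3 \<Rightarrow> real^2) \<Rightarrow> 3 \<Rightarrow> real^2 \<Rightarrow> real^2" where
  "F p i x = (1/2) *\<^sub>R (x - p i) + p i"

definition SG :: "(3 \<Rightarrow> real^2) \<Rightarrow> (real^2) set" where
  "SG p = (THE K. compact K \<and> K \<noteq> {} \<and> K = (\<Union>i. F p i ` K))"

definition F_word :: "(3 \<Rightarrow> real^2) \<Rightarrow> 3 list \<Rightarrow> real^2 \<Rightarrow> real^2" where
  "F_word p w = foldr (F p) w"

definition V0 :: "(3 \<Rightarrow> real^2) \<Rightarrow> (real^2) set" where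
  "V0 p = range p"

text \<open>Only the values of \<open>u\<close> on the gasket matter below. The \<open>\<delta>\<close>-neighbourhood is taken
  inside the gasket, with respect to the Euclidean metric; \<open>components\<close> yields
  nonempty sets only.\<close>

definition nbhd_SG :: "(3 \<Rightarrow> real^2) \<Rightarrow> (real^2) set \<Rightarrow> real \<Rightarrow> (real^2) set" where
  "nbhd_SG p A d = {x \<in> SG p. \<exists>y\<in>A. dist x y < d}"

definition extreme_set :: "(3 \<Rightarrow> real^2) \<Rightarrow> (real^2 \<Rightarrow> real) \<Rightarrow> (real^2) set \<Rightarrow> bool" where
  "extreme_set p u A \<longleftrightarrow>
     (\<exists>c. A \<in> components {x \<in> SG p. u x = c} \<and> A \<inter> V0 p = {} \<and>
        (\<exists>d>0. (\<forall>x\<in>nbhd_SG p A d. u x \<le> c) \<or> (\<forall>x\<in>nbhd_SG p A d. u x \<ge> c)))"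

definition Extr :: "(3 \<Rightarrow> real^2) \<Rightarrow> (real^2 \<Rightarrow> real) \<Rightarrow> (real^2) set set" where
  "Extr p u = {A. extreme_set p u A}"

definition phi :: "int \<Rightarrow> real \<Rightarrow> real" where
  "phi e x = (5 + of_int e * sqrt (25 - 4 * x)) / 2"

text \<open>\<open>fold\<close> applies the first letter first, so this is
  \<open>\<phi>\<^bsub>\<epsilon>n\<^esub> \<circ> \<dots> \<circ> \<phi>\<^bsub>\<epsilon>1\<^esub>\<close>.\<close>

definition phi_word :: "int list \<Rightarrow> real \<Rightarrow> real" where
  "phi_word eps = fold phi eps"

definition psi :: "real \<Rightarrow> real" where
  "psi x = 3/2 * lim (\<lambda>m. 5 ^ m * (phi (-1) ^^ m) x)"

text \<open>The list \<open>eps\<close> is indexed from \<open>0\<close>: \<open>eps ! m\<close> is \<open>\<epsilon>\<^bsub>m+1\<^esub>\<close>.\<close>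

primrec lam_seq :: "real \<Rightarrow> int list \<Rightarrow> nat \<Rightarrow> real" where
  "lam_seq l0 eps 0 = l0"
| "lam_seq l0 eps (Suc m) = phi (if m < length eps then eps ! m else -1) (lam_seq l0 eps m)"

definition eigenvalue :: "real \<Rightarrow> int list \<Rightarrow> real" where
  "eigenvalue l0 eps = 5 ^ length eps * psi (phi_word eps l0)"

text \<open>\<open>u\<close> is the function \<open>u\<^sup>\<epsilon>\<close>. Since the points \<open>F\<^sub>w p\<^sub>i\<close> are dense in the gasket,
  these conditions determine \<open>u\<close> on the gasket.\<close>

definition is_u_eps ::
  "(3 \<Rightarrow> real^2) \<Rightarrow> real \<Rightarrow> real^3 \<Rightarrow> int list \<Rightarrow> (real^2 \<Rightarrow> real) \<Rightarrow> bool" where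
  "is_u_eps p l0 a eps u \<longleftrightarrow>
     continuous_on (SG p) u \<and>
     (\<forall>i. u (p i) = a $ i) \<and>
     (\<forall>w i j k. i \<noteq> j \<and> j \<noteq> k \<and> i \<noteq> k \<longrightarrow>
        (let l = lam_seq l0 eps (Suc (length w)) in
         u (F_word p w (F p i (p j))) =
           ((4 - l) * (u (F_word p w (p i)) + u (F_word p w (p j))) + 2 * u (F_word p w (p k)))
             / ((2 - l) * (5 - l))))"

definition d_S :: real where
  "d_S = ln 9 / ln 5"

end

theory Submission
  imports Defs
begin

text \<open>
  Let \<open>l\<^sub>m = lam_seq l0 eps m\<close>. On a cell \<open>F\<^sub>w SG\<close> with \<open>|w| = m\<close> the function \<open>u\<close> is determined by
  its three corner values, hence by the three outward normal derivatives \<open>D\<^sub>1, D\<^sub>2, D\<^sub>3\<close> at the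
  corners, which are (up to a factor depending on \<open>m\<close> only) a linear image of the corner values.
  The proof rests on the fact that spectral decimation becomes very simple in these coordinates:
  on the \<open>i\<close>-th child of the cell the derivative at the old corner is a multiple of \<open>D\<^sub>i\<close>, and the
  derivative at the midpoint towards corner \<open>j\<close> is a multiple of \<open>D\<^sub>j - D\<^sub>i\<close>
  (\<open>D_child_same\<close>, \<open>D_child_other\<close>). The first is natural, as the derivative at a given
  point is the same seen from the child; the second is forced by antisymmetry, as the midpoint is a
  junction of the children \<open>i\<close> and \<open>j\<close>. Moreover corner values are ordered as the derivatives.

  Because \<open>\<epsilon>\<^sub>n = 1\<close> we have \<open>3 < l\<^sub>n < 5\<close>, and \<open>l\<^sub>m < 2\<close> for all \<open>m > n\<close>. From level \<open>n\<close> on both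
  multipliers are therefore positive, and an induction over subcells gives a maximum principle:
  if some \<open>D\<^sub>i \<ge> 0\<close>, the maximum of \<open>u\<close> over the cell is attained at a corner. Looking at the signs of
  the derivatives of the children, one finds that a local maximum that is not a corner occurs only
  in two situations, if \<open>D \<noteq> 0\<close>. Either one derivative is negative and two vanish; then \<open>u\<close> is constant on the
  side joining the latter two corners, and the local maximum lies on that side. Or all derivatives
  are negative; then the local maxima off the corners lie in a single point or in a triangle
  of edges (\<open>sunk_cases\<close>). Apart from the extreme sets that contain a corner of an \<open>n\<close>-cell, an \<open>n\<close>-cell
  thus meets at most one extreme set, and \<open>#Extr \<le> 3\<^sup>n\<^sup>+\<^sup>1 + 3\<^sup>n\<close>.

  In the step from level \<open>n - 1\<close> to level \<open>n\<close> the multiplier of \<open>D\<^sub>i\<close> is negative while that of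
  \<open>D\<^sub>j - D\<^sub>i\<close> is positive. Hence if the least derivative of an \<open>(n-1)\<close>-cell is negative, \<open>u\<close> increases
  towards all boundary points of the union of those children that belong to this least value, and
  the minimum over this union is attained only off these points, which gives an extreme set. No cell has
  \<open>D = 0\<close>, because the passage to a child is an invertible linear map and \<open>a \<noteq> 0\<close>; so, after
  replacing \<open>u\<close> by \<open>-u\<close> where necessary, every \<open>(n-1)\<close>-cell contains an extreme set off its
  corners, and \<open>#Extr \<ge> 3\<^sup>n\<^sup>-\<^sup>1\<close>.

  Finally \<open>d\<^sub>S/2 = ln 3 / ln 5\<close>, so the eigenvalue raised to this power is \<open>3\<^sup>n\<close> times a power of
  \<open>\<psi>(l\<^sub>n)\<close>, and \<open>1 \<le> \<psi> \<le> 17\<close> on \<open>(3,5)\<close>.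
\<close>

section \<open>The gasket as an attractor\<close>

lemma distinct3_UNIV:
  fixes i j k :: 3
  assumes "i \<noteq> j" "j \<noteq> k" "i \<noteq> k"
  shows "UNIV = {i, j, k}"
proof -
  have "card {i, j, k} = CARD(3)" using assms by simp
  then have "{i, j, k} = UNIV" by (intro card_subset_eq) auto
  then show ?thesis by simp
qed

lemma sum_distinct3:
  fixes i j k :: 3 and f :: "3 \<Rightarrow> 'a::comm_monoid_add"
  assumes "i \<noteq> j" "j \<noteq> k" "i \<noteq> k"
  shows "(\<Sum>x\<in>UNIV. f x) = f i + f j + f k"
  using assms by (simp add: distinct3_UNIV[OF assms] add.assoc)

lemma third_index: 
  fixes i j :: 3
  assumes "i \<noteq> j" obtains k where "j \<noteq> k" "i \<noteq> k"
proof -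
  have "card {i, j} < CARD(3)" using card_insert_le[of "{j}" i] by (simp add: assms)
  then have "{i, j} \<noteq> UNIV" by (metis less_irrefl)
  then obtain k where "k \<notin> {i, j}" by blast
  then show ?thesis by (intro that[of k]) auto
qed

lemma ordered_indices:
  fixes f :: "3 \<Rightarrow> 'a::linorder"
  obtains i j k where "i \<noteq> j" "j \<noteq> k" "i \<noteq> k" "f k \<le> f j" "f j \<le> f i"
proof -
  obtain i where i: "\<And>x. f x \<le> f i"
  proof -
    have "Max (range f) \<in> range f" by (rule Max_in) auto
    then obtain i where "Max (range f) = f i" by blast
    then show ?thesis using that[of i] Max_ge[of "range f"] by (metis finite finite_imageI rangeI)
  qed
  obtain a where a: "i \<noteq> a" by (metis zero_neq_one)
  obtain b where b: "a \<noteq> b" "i \<noteq> b" using third_index[OF a] by blast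
  show ?thesis
    using that[of i a b] that[of i b a] a b i by (metis linorder_linear)
qed

lemma F_dist: "dist (F p i x) (F p i y) = dist x y / 2"
proof -
  have "F p i x - F p i y = (1/2) *\<^sub>R (x - y)"
    by (simp add: F_def algebra_simps)
  then show ?thesis by (simp add: dist_norm)
qed

lemma F_inj: "F p i x = F p i y \<longleftrightarrow> x = y"
  using F_dist[of p i x y] by (metis dist_eq_0_iff divide_eq_0_iff zero_neq_numeral)

lemma F_fixed: "F p i (p i) = p i"
  by (simp add: F_def)

lemma F_midpoint: "F p i (p j) = midpoint (p i) (p j)"
  by (simp add: F_def midpoint_def vec_eq_iff field_simps)

lemma F_swap: "F p i (p j) = F p j (p i)"
  by (simp add: F_midpoint midpoint_sym)

lemma F_continuous: "continuous_on A (F p i)"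
  unfolding F_def by (intro continuous_intros)

text \<open>A point of \<open>L\<close> farthest from \<open>K\<close> is the image of a point of \<open>L\<close> under a contraction that
  halves the distance to \<open>K\<close>, so the farthest distance is \<open>0\<close>. Besides uniqueness of the gasket
  this yields all inclusions between self-similar sets that are needed below.\<close>
lemma attractor_subset:
  assumes L: "compact L" "L \<subseteq> (\<Union>i. F p i ` L)"
    and K: "closed K" "K \<noteq> {}" "(\<Union>i. F p i ` K) \<subseteq> K"
  shows "L \<subseteq> K"
proof (cases "L = {}")
  case False
  have "continuous_on L (\<lambda>x. infdist x K)" by (intro continuous_intros)
  then obtain x where x: "x \<in> L" "\<And>y. y \<in> L \<Longrightarrow> infdist y K \<le> infdist x K"
    using continuous_attains_sup[OF L(1) False] by blast
  obtain i y where y: "y \<in> L" "x = F p i y" using x(1) L(2) by blast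
  obtain z where z: "z \<in> K" "infdist y K = dist y z"
    using infdist_attains_inf[OF K(1,2)] by blast
  have "F p i z \<in> K" using z(1) K(3) by blast
  then have "infdist x K \<le> dist x (F p i z)" by (rule infdist_le)
  also have "\<dots> = infdist y K / 2" using y z by (simp add: F_dist)
  also have "\<dots> \<le> infdist x K / 2" using x(2) y(1) by simp
  finally have "infdist x K \<le> 0" by simp
  then have "infdist y K = 0" if "y \<in> L" for y
    using x(2)[OF that] infdist_nonneg[of y K] by linarith
  then show ?thesis using in_closed_iff_infdist_zero[OF K(1,2)] by blast
qed simp

text \<open>The attractor is the intersection of the iterated images of a ball that every map sends into
  itself. The only delicate point is that a point of the intersection lies in the image of the whole
  intersection under one and the same map; this holds because there are finitely many maps.\<close>
lemma attractor_exists: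
  obtains K where "compact K" "range p \<subseteq> K" "K = (\<Union>i. F p i ` K)"
proof -
  define H where "H A = (\<Union>i. F p i ` A)" for A
  define R where "R = Max (range (\<lambda>i. norm (p i)))"
  have R: "norm (p i) \<le> R" for i unfolding R_def by (rule Max_ge) auto
  define T where "T m = (H ^^ m) (cball 0 R)" for m
  have T_Suc: "T (Suc m) = (\<Union>i. F p i ` T m)" for m by (simp add: T_def H_def)
  have sub0: "T (Suc 0) \<subseteq> T 0"
  proof -
    have "norm (F p i x) \<le> R" if "norm x \<le> R" for i x
    proof -
      have "F p i x = (1/2) *\<^sub>R (x + p i)"
        by (simp add: F_def vec_eq_iff field_simps)
      then have "norm (F p i x) = norm (x + p i) / 2" by simp
      also have "\<dots> \<le> R" using norm_triangle_ineq[of x "p i"] R[of i] that by simp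
      finally show ?thesis .
    qed
    then show ?thesis unfolding T_Suc by (auto simp: T_def)
  qed
  have sub: "T (Suc m) \<subseteq> T m" for m
  proof (induction m)
    case (Suc m) then show ?case by (subst (1 2) T_Suc) blast
  qed (rule sub0)
  then have dec: "T n \<subseteq> T m" if "m \<le> n" for m n
    using lift_Suc_antimono_le[of T, OF _ that] by blast
  have comp: "compact (T m)" for m
  proof (induction m)
    case 0 show ?case by (simp add: T_def)
  next
    case (Suc m) then show ?case unfolding T_Suc
      by (intro compact_UN compact_continuous_image F_continuous) auto
  qed
  have pT: "p i \<in> T m" for i m
  proof (induction m)
    case 0 show ?case using R by (simp add: T_def)
  next
    case (Suc m) then show ?case unfolding T_Suc by (metis F_fixed UNIV_I UN_I imageI)
  qed
  define K where "K = (\<Inter>m. T m)"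
  have "compact K" unfolding K_def by (rule compact_Inter) (use comp in auto)
  moreover have "range p \<subseteq> K" unfolding K_def using pT by blast
  moreover have "K = (\<Union>i. F p i ` K)"
  proof
    show "(\<Union>i. F p i ` K) \<subseteq> K"
    proof -
      have "F p i x \<in> T m" if "x \<in> K" for i x m
        using that sub[of m] T_Suc[of m] unfolding K_def by blast
      then show ?thesis unfolding K_def by blast
    qed
    show "K \<subseteq> (\<Union>i. F p i ` K)"
    proof
      fix x assume x: "x \<in> K"
      show "x \<in> (\<Union>i. F p i ` K)"
      proof (rule ccontr)
        assume no: "x \<notin> (\<Union>i. F p i ` K)"
        have "\<exists>m. x \<notin> F p i ` T m" for i
        proof (rule ccontr)
          assume "\<nexists>m. x \<notin> F p i ` T m"
          then have all: "x \<in> F p i ` T m" for m by blast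
          then obtain y where y: "x = F p i y" by blast
          have "y \<in> T m" for m using all[of m] unfolding y by (auto simp: F_inj)
          then have "y \<in> K" by (simp add: K_def)
          then show False using no y by blast
        qed
        then obtain m where m: "\<And>i. x \<notin> F p i ` T (m i)" by metis
        define M where "M = Max (range m)"
        have "m i \<le> M" for i unfolding M_def by (rule Max_ge) auto
        then have "x \<notin> F p i ` T M" for i using m dec by blast
        then have "x \<notin> T (Suc M)" by (subst T_Suc) blast
        then show False using x unfolding K_def by blast
      qed
    qed
  qed
  ultimately show ?thesis using that by blast
qed

lemma SG_unique:
  assumes "compact K" "K \<noteq> {}" "K = (\<Union>i. F p i ` K)"
  shows "SG p = K"
  unfolding SG_def
proof (rule the_equality)
  show "compact K \<and> K \<noteq> {} \<and> K = (\<Union>i. F p i ` K)" using assms by blast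
next
  fix L assume L: "compact L \<and> L \<noteq> {} \<and> L = (\<Union>i. F p i ` L)"
  show "L = K"
  proof
    show "L \<subseteq> K" by (rule attractor_subset[where p=p]) (use L assms compact_imp_closed in auto)
    show "K \<subseteq> L" by (rule attractor_subset[where p=p]) (use L assms compact_imp_closed in auto)
  qed
qed

lemma
  shows SG_compact: "compact (SG p)" and p_in_SG: "p i \<in> SG p"
    and SG_self_similar: "SG p = (\<Union>i. F p i ` SG p)"
proof -
  obtain K where K: "compact K" "range p \<subseteq> K" "K = (\<Union>i. F p i ` K)"
    using attractor_exists by blast
  then have "SG p = K" by (intro SG_unique) auto
  then show "compact (SG p)" "p i \<in> SG p" "SG p = (\<Union>i. F p i ` SG p)" using K by auto
qed

section \<open>Cells\<close>

text \<open>The cell \<open>F\<^sub>w SG\<close> and its corners \<open>F\<^sub>w p\<^sub>i\<close>. Passing from \<open>w\<close> to \<open>w @ [i]\<close> refines the cell, so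
  most inductions append letters at the end.\<close>
definition cell :: "(3 \<Rightarrow> real^2) \<Rightarrow> 3 list \<Rightarrow> (real^2) set" where
  "cell p w = F_word p w ` SG p"

definition vtx :: "(3 \<Rightarrow> real^2) \<Rightarrow> 3 list \<Rightarrow> 3 \<Rightarrow> real^2" where
  "vtx p w i = F_word p w (p i)"

lemma F_word_simps [simp]:
  "F_word p [] x = x" "F_word p (i # w) x = F p i (F_word p w x)"
  "F_word p (v @ w) x = F_word p v (F_word p w x)"
  by (simp_all add: F_word_def)

lemma F_word_dist: "dist (F_word p w x) (F_word p w y) = dist x y / 2 ^ length w"
  by (induction w) (simp_all add: F_dist)

lemma F_word_affine:
  "F_word p w ((1 - t) *\<^sub>R x + t *\<^sub>R y) = (1 - t) *\<^sub>R F_word p w x + t *\<^sub>R F_word p w y"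
proof (induction w)
  case (Cons i w)
  have "F p i ((1 - t) *\<^sub>R a + t *\<^sub>R b) = (1 - t) *\<^sub>R F p i a + t *\<^sub>R F p i b" for a b
    by (simp add: F_def vec_eq_iff field_simps)
  with Cons show ?case by simp
qed simp

lemma F_word_midpoint: "F_word p w (midpoint x y) = midpoint (F_word p w x) (F_word p w y)"
  using F_word_affine[of p w "1/2" x y] by (simp add: midpoint_def scaleR_add_right)

lemma F_word_segment: "F_word p w ` closed_segment x y = closed_segment (F_word p w x) (F_word p w y)"
  unfolding closed_segment_def by (auto simp: F_word_affine image_iff) (metis F_word_affine)

text \<open>A side of the triangle is the union of two of its images, hence part of the attractor.\<close>
lemma segment_subset_SG: "closed_segment (p i) (p j) \<subseteq> SG p"
proof (rule attractor_subset[where p = p])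
  show "closed_segment (p i) (p j) \<subseteq> (\<Union>k. F p k ` closed_segment (p i) (p j))"
  proof -
    have F: "F p k ` closed_segment (p i) (p j) = closed_segment (F p k (p i)) (F p k (p j))" for k
      using F_word_segment[of p "[k]"] by simp
    have "closed_segment (p i) (p j)
        = closed_segment (p i) (midpoint (p i) (p j)) \<union> closed_segment (midpoint (p i) (p j)) (p j)"
      by (rule Un_closed_segment[symmetric]) simp
    also have "\<dots> = F p i ` closed_segment (p i) (p j) \<union> F p j ` closed_segment (p i) (p j)"
      unfolding F F_fixed F_midpoint midpoint_sym[of "p j"] ..
    finally show ?thesis by blast
  qed
  show "closed (SG p)" by (rule compact_imp_closed[OF SG_compact])
  show "SG p \<noteq> {}" using p_in_SG by blast
  show "(\<Union>k. F p k ` SG p) \<subseteq> SG p" using SG_self_similar by blast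
qed simp

lemma cell_Nil [simp]: "cell p [] = SG p"
  by (simp add: cell_def image_def)

lemma cell_children: "cell p w = (\<Union>i. cell p (w @ [i]))"
proof -
  have "cell p w = F_word p w ` (\<Union>i. F p i ` SG p)"
    unfolding cell_def using SG_self_similar[of p] by simp
  also have "\<dots> = (\<Union>i. cell p (w @ [i]))" by (auto simp: cell_def)
  finally show ?thesis .
qed

lemma cell_child_subset: "cell p (w @ [i]) \<subseteq> cell p w"
  using cell_children by blast

lemma cell_append_subset: "cell p (w @ v) \<subseteq> cell p w"
proof (induction v rule: rev_induct)
  case (snoc i v)
  then show ?case using cell_child_subset[of p "w @ v" i] by auto
qed simp

lemma cell_subset_SG: "cell p w \<subseteq> SG p"
  using cell_append_subset[of p "[]" w] by simp

lemma vtx_in_cell: "vtx p w i \<in> cell p w"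
  by (simp add: vtx_def cell_def p_in_SG)

lemma edge_subset_cell: "closed_segment (vtx p w i) (vtx p w j) \<subseteq> cell p w"
  unfolding vtx_def cell_def F_word_segment[symmetric] using segment_subset_SG by (rule image_mono)

lemma vtx_in_SG: "vtx p w i \<in> SG p"
  using vtx_in_cell cell_subset_SG by blast

lemma vtx_child_same: "vtx p (w @ [i]) i = vtx p w i"
  by (simp add: vtx_def F_fixed)

lemma vtx_replicate: "vtx p (w @ replicate k i) i = vtx p w i"
proof (induction k)
  case (Suc k)
  have "w @ replicate (Suc k) i = (w @ replicate k i) @ [i]"
    by (simp add: replicate_append_same)
  then show ?case by (simp only: vtx_child_same Suc)
qed simp

lemma vtx_child_swap: "vtx p (w @ [i]) j = vtx p (w @ [j]) i"
  by (simp add: vtx_def F_swap[of p i j])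

lemma vtx_child_midpoint: "vtx p (w @ [i]) j = midpoint (vtx p w i) (vtx p w j)"
  by (simp add: vtx_def F_midpoint F_word_midpoint)

lemma cell_compact: "compact (cell p w)"
proof -
  have "continuous_on (SG p) (\<lambda>x. F_word p w x)"
  proof (induction w)
    case (Cons i w)
    then show ?case by (simp add: F_def) (intro continuous_intros)
  qed simp
  then show ?thesis unfolding cell_def by (intro compact_continuous_image SG_compact)
qed

lemma cell_cover: "x \<in> cell p w \<Longrightarrow> \<exists>v. length v = m \<and> x \<in> cell p (w @ v)"
proof (induction m)
  case (Suc m)
  then obtain v where "length v = m" "x \<in> cell p (w @ v)" by blast
  then obtain s where "x \<in> cell p ((w @ v) @ [s])" using cell_children[of p "w @ v"] by blast
  then show ?case using \<open>length v = m\<close> by (intro exI[of _ "v @ [s]"]) simp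
qed simp

lemma cells_shrink:
  assumes "0 < d"
  obtains m where "\<And>w x y. \<lbrakk>m \<le> length w; x \<in> cell p w; y \<in> cell p w\<rbrakk> \<Longrightarrow> dist x y < d"
proof -
  obtain R where R: "R > 0" "\<And>x y. x \<in> SG p \<Longrightarrow> y \<in> SG p \<Longrightarrow> dist x y \<le> R"
  proof -
    obtain e where e: "\<forall>x\<in>SG p. \<forall>y\<in>SG p. dist x y \<le> e"
      using compact_imp_bounded[OF SG_compact] bounded_two_points by blast
    show ?thesis
    proof (rule that[of "max e 1"])
      fix x y assume "x \<in> SG p" "y \<in> SG p"
      then have "dist x y \<le> e" using e by blast
      then show "dist x y \<le> max e 1" by simp
    qed simp
  qed
  obtain m where m: "R / d < 2 ^ m" using real_arch_pow[of 2 "R/d"] by auto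
  show ?thesis
  proof (rule that[of m])
    fix w x y assume w: "m \<le> length w" and "x \<in> cell p w" "y \<in> cell p w"
    then obtain a b where ab: "a \<in> SG p" "b \<in> SG p" "x = F_word p w a" "y = F_word p w b"
      unfolding cell_def by blast
    have "R < d * 2 ^ m" using m assms by (simp add: field_simps)
    also have "\<dots> \<le> d * 2 ^ length w" using w assms by simp
    finally have "dist a b < d * 2 ^ length w" using R(2)[OF ab(1,2)] by linarith
    then show "dist x y < d" using ab by (simp add: F_word_dist field_simps)
  qed
qed

lemma cells_eqI:
  assumes "\<And>m. \<exists>v. m \<le> length v \<and> x \<in> cell p v \<and> y \<in> cell p v"
  shows "x = y"
proof (rule ccontr)
  assume "x \<noteq> y"
  then have "0 < dist x y" by simp
  then obtain m where "\<And>w a b. \<lbrakk>m \<le> length w; a \<in> cell p w; b \<in> cell p w\<rbrakk> \<Longrightarrow> dist a b < dist x y"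
    using cells_shrink by blast
  then show False using assms[of m] by blast
qed

text \<open>By continuity and since cells shrink, a closed condition that holds somewhere in each of the small
  cells around a point, such as at a corner, holds at the point itself.\<close>
lemma cells_limit:
  fixes f :: "real^2 \<Rightarrow> 'a::metric_space"
  assumes f: "continuous_on (SG p) f" and S: "closed S"
    and x: "\<And>m. \<exists>v y. m \<le> length v \<and> x \<in> cell p v \<and> y \<in> cell p v \<and> f y \<in> S"
  shows "f x \<in> S"
proof (rule ccontr)
  assume "f x \<notin> S"
  then obtain e where e: "e > 0" "ball (f x) e \<subseteq> - S"
    using S open_contains_ball[of "- S"] by auto
  have xS: "x \<in> SG p" using x cell_subset_SG by blast
  obtain d where d: "d > 0" "\<And>y. y \<in> SG p \<Longrightarrow> dist y x < d \<Longrightarrow> dist (f y) (f x) < e"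
    using f xS e(1) unfolding continuous_on_iff by meson
  obtain m where m: "\<And>w x y. \<lbrakk>m \<le> length w; x \<in> cell p w; y \<in> cell p w\<rbrakk> \<Longrightarrow> dist x y < d"
    using cells_shrink[OF d(1)] by blast
  obtain v y where v: "m \<le> length v" "x \<in> cell p v" "y \<in> cell p v" "f y \<in> S"
    using x by blast
  then have "dist (f y) (f x) < e" using d(2)[of y] m[of v y x] cell_subset_SG by blast
  then have "f y \<in> ball (f x) e" by (simp add: dist_commute)
  with e(2) v show False by blast
qed

lemma card_words: "card {w :: 3 list. length w = m} = 3 ^ m"
  and finite_words: "finite {w :: 3 list. length w = m}"
  using card_lists_length_eq[of "UNIV :: 3 set" m] finite_lists_length_eq[of "UNIV :: 3 set" m]
  by simp_all

section \<open>How cells meet\<close>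

lemma inner_equilateral:
  assumes s: "\<And>i j. i \<noteq> j \<Longrightarrow> dist (p i) (p j) = s" and "i \<noteq> j" "i \<noteq> k" "j \<noteq> k"
  shows "(p i - p j) \<bullet> (p i - p k) = s\<^sup>2 / 2"
proof -
  have sq: "(p a - p b) \<bullet> (p a - p b) = s\<^sup>2" if "a \<noteq> b" for a b
    using s[OF that] by (simp add: dist_norm power2_norm_eq_inner[symmetric])
  have "(p k - p j) \<bullet> (p k - p j) = (p i - p j) \<bullet> (p i - p j) + (p i - p k) \<bullet> (p i - p k)
      - 2 * ((p i - p j) \<bullet> (p i - p k))"
    by (simp add: inner_diff inner_commute algebra_simps)
  then show ?thesis using sq assms by simp
qed

text \<open>Explicit affine functions are used because they interact with \<open>F p k\<close> by plain averaging.\<close>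
lemma barycentric_coordinates:
  assumes "equilateral p"
  obtains b :: "3 \<Rightarrow> real^2 \<Rightarrow> real"
  where "\<And>i. b i (p i) = 1" "\<And>i j. i \<noteq> j \<Longrightarrow> b i (p j) = 0"
    "\<And>i k x. b i (F p k x) = (b i x + b i (p k)) / 2" "\<And>i. continuous_on UNIV (b i)"
proof -
  obtain s where s: "s > 0" "\<And>i j. i \<noteq> j \<Longrightarrow> dist (p i) (p j) = s"
    using assms unfolding equilateral_def by blast
  \<comment> \<open>The vector \<open>3 p\<^sub>i - (p\<^sub>1 + p\<^sub>2 + p\<^sub>3)\<close> is perpendicular to the side opposite to \<open>p\<^sub>i\<close> and has inner
    product \<open>3 s\<^sup>2 / 2\<close> with \<open>p\<^sub>i - p\<^sub>j\<close>.\<close>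
  define q where "q = 2 / (3 * s\<^sup>2)"
  define b where "b i x = 1 - q * ((p i - x) \<bullet> (3 *\<^sub>R p i - (\<Sum>j\<in>UNIV. p j)))" for i x
  show thesis
  proof (rule that[of b])
    show "b i (p i) = 1" for i by (simp add: b_def)
    show "b i (p j) = 0" if ij: "i \<noteq> j" for i j
    proof -
      obtain k where k: "j \<noteq> k" "i \<noteq> k" using third_index[OF ij] by blast
      have "3 *\<^sub>R p i - (\<Sum>j\<in>UNIV. p j) = (p i - p j) + (p i - p k)"
        unfolding sum_distinct3[OF ij k] by (simp add: vec_eq_iff)
      then have "(p i - p j) \<bullet> (3 *\<^sub>R p i - (\<Sum>j\<in>UNIV. p j))
          = (p i - p j) \<bullet> (p i - p j) + (p i - p j) \<bullet> (p i - p k)"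
        by (simp only: inner_add_right)
      also have "(p i - p j) \<bullet> (p i - p j) = s\<^sup>2"
        using s(2)[OF ij] by (simp add: dist_norm power2_norm_eq_inner[symmetric])
      also have "(p i - p j) \<bullet> (p i - p k) = s\<^sup>2 / 2"
        by (rule inner_equilateral[OF s(2)]) (use ij k in auto)
      finally show ?thesis using s(1) by (simp add: b_def q_def field_simps)
    qed
    show "b i (F p k x) = (b i x + b i (p k)) / 2" for i k x
    proof -
      have "p i - F p k x = (1/2) *\<^sub>R ((p i - x) + (p i - p k))"
        by (simp add: F_def vec_eq_iff field_simps)
      then have "(p i - F p k x) \<bullet> v = ((p i - x) \<bullet> v + (p i - p k) \<bullet> v) / 2" for v
        by (simp only: inner_scaleR_left inner_add_left)
      then show ?thesis unfolding b_def by (simp add: field_simps)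
    qed
    show "continuous_on UNIV (b i)" for i unfolding b_def by (intro continuous_intros)
  qed
qed

text \<open>The points with nonnegative coordinates of sum \<open>1\<close> that are recovered from their coordinates
  form a closed set invariant under the maps, so it contains the gasket.\<close>
lemma gasket_coordinates:
  assumes "equilateral p"
  obtains b :: "3 \<Rightarrow> real^2 \<Rightarrow> real"
  where "\<And>i j. i \<noteq> j \<Longrightarrow> b i (p j) = 0"
    "\<And>x i. x \<in> F p i ` SG p \<Longrightarrow> 1/2 \<le> b i x"
    "\<And>x i. x \<in> SG p \<Longrightarrow> 0 \<le> b i x"
    "\<And>x. x \<in> SG p \<Longrightarrow> (\<Sum>i\<in>UNIV. b i x) = 1"
    "\<And>x. x \<in> SG p \<Longrightarrow> (\<Sum>i\<in>UNIV. b i x *\<^sub>R p i) = x"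
proof -
  obtain b :: "3 \<Rightarrow> real^2 \<Rightarrow> real"
    where b: "\<And>i. b i (p i) = 1" "\<And>i j. i \<noteq> j \<Longrightarrow> b i (p j) = 0"
      "\<And>i k x. b i (F p k x) = (b i x + b i (p k)) / 2" "\<And>i. continuous_on UNIV (b i)"
    using barycentric_coordinates[OF assms] by blast
  have p01: "b i (p k) = (if i = k then 1 else 0)" for i k using b(1,2) by simp
  define T where "T = {x. (\<forall>i. 0 \<le> b i x) \<and> (\<Sum>i\<in>UNIV. b i x) = 1 \<and> (\<Sum>i\<in>UNIV. b i x *\<^sub>R p i) = x}"
  have "SG p \<subseteq> T"
  proof (rule attractor_subset[where p = p])
    show "compact (SG p)" by (rule SG_compact)
    show "SG p \<subseteq> (\<Union>i. F p i ` SG p)" using SG_self_similar by blast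
    show "closed T" unfolding T_def
      by (intro closed_Collect_conj closed_Collect_all closed_Collect_le closed_Collect_eq
          continuous_intros b(4))
    have "(\<Sum>i\<in>UNIV. b i (p k) *\<^sub>R p i) = p k" for k
      by (simp add: p01 if_distrib[of "\<lambda>c. c *\<^sub>R _"] cong: if_cong)
    then have "p 1 \<in> T" unfolding T_def by (simp add: p01)
    then show "T \<noteq> {}" by blast
    show "(\<Union>k. F p k ` T) \<subseteq> T"
    proof clarify
      fix k x assume "x \<in> T"
      then have x: "\<And>i. 0 \<le> b i x" "(\<Sum>i\<in>UNIV. b i x) = 1" "(\<Sum>i\<in>UNIV. b i x *\<^sub>R p i) = x"
        unfolding T_def by auto
      have "0 \<le> b i (F p k x)" for i using x(1)[of i] by (simp add: b(3) p01)
      moreover have "(\<Sum>i\<in>UNIV. b i (F p k x)) = 1"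
        by (simp add: b(3) p01 add_divide_distrib sum.distrib x(2) flip: sum_divide_distrib)
      moreover have "(\<Sum>i\<in>UNIV. b i (F p k x) *\<^sub>R p i) = F p k x"
      proof -
        have "(\<Sum>i\<in>UNIV. b i (F p k x) *\<^sub>R p i)
            = (\<Sum>i\<in>UNIV. (1/2) *\<^sub>R (b i x *\<^sub>R p i) + (1/2) *\<^sub>R (if i = k then p k else 0))"
          by (rule sum.cong) (auto simp: b(3) p01 vec_eq_iff field_simps)
        also have "\<dots> = (1/2) *\<^sub>R x + (1/2) *\<^sub>R p k"
          unfolding sum.distrib scaleR_sum_right[symmetric] x(3) by simp
        also have "\<dots> = F p k x" by (simp add: F_def vec_eq_iff field_simps)
        finally show ?thesis .
      qed
      ultimately show "F p k x \<in> T" unfolding T_def by blast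
    qed
  qed
  then have T: "x \<in> SG p \<Longrightarrow> x \<in> T" for x by blast
  show thesis
  proof (rule that[of b])
    show "1/2 \<le> b i x" if "x \<in> F p i ` SG p" for x i
      using that T unfolding T_def by (auto simp: b(3) p01)
  qed (use b(2) T in \<open>auto simp: T_def\<close>)
qed

text \<open>A common point has two coordinates \<open>\<ge> 1/2\<close>, which leaves nothing for the third.\<close>
lemma first_cells_meet:
  assumes "equilateral p" "i \<noteq> j" "x \<in> F p i ` SG p" "x \<in> F p j ` SG p"
  shows "x = F p i (p j)"
proof -
  obtain b :: "3 \<Rightarrow> real^2 \<Rightarrow> real"
    where b0: "\<And>i j. i \<noteq> j \<Longrightarrow> b i (p j) = 0"
      and b: "\<And>x i. x \<in> F p i ` SG p \<Longrightarrow> 1/2 \<le> b i x"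
      "\<And>x i. x \<in> SG p \<Longrightarrow> 0 \<le> b i x"
      "\<And>x. x \<in> SG p \<Longrightarrow> (\<Sum>i\<in>UNIV. b i x) = 1"
      "\<And>x. x \<in> SG p \<Longrightarrow> (\<Sum>i\<in>UNIV. b i x *\<^sub>R p i) = x"
    using gasket_coordinates[OF assms(1)] by blast
  have x: "x \<in> SG p" using assms(3) SG_self_similar by blast
  obtain k where k: "j \<noteq> k" "i \<noteq> k" using third_index[OF assms(2)] by blast
  have "b i x + b j x + b k x = 1" using b(3)[OF x] by (simp add: sum_distinct3[OF assms(2) k])
  then have v: "b i x = 1/2" "b j x = 1/2" "b k x = 0"
    using b(1)[OF assms(3)] b(1)[OF assms(4)] b(2)[OF x, of k] by linarith+
  have "x = (1/2) *\<^sub>R p i + (1/2) *\<^sub>R p j"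
    using b(4)[OF x] v by (simp add: sum_distinct3[OF assms(2) k])
  then show ?thesis by (simp add: F_midpoint midpoint_def scaleR_add_right)
qed

lemma p_in_first_cell:
  assumes "equilateral p" "p j \<in> F p k ` SG p"
  shows "k = j"
proof (rule ccontr)
  assume "k \<noteq> j"
  obtain b :: "3 \<Rightarrow> real^2 \<Rightarrow> real"
    where b0: "\<And>i j. i \<noteq> j \<Longrightarrow> b i (p j) = 0"
      and b: "\<And>x i. x \<in> F p i ` SG p \<Longrightarrow> 1/2 \<le> b i x"
      "\<And>x i. x \<in> SG p \<Longrightarrow> 0 \<le> b i x"
      "\<And>x. x \<in> SG p \<Longrightarrow> (\<Sum>i\<in>UNIV. b i x) = 1"
      "\<And>x. x \<in> SG p \<Longrightarrow> (\<Sum>i\<in>UNIV. b i x *\<^sub>R p i) = x"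
    using gasket_coordinates[OF assms(1)] by blast
  show False using b0[OF \<open>k \<noteq> j\<close>] b(1)[OF assms(2)] by simp
qed

lemma cell_Cons: "cell p (i # w) = F p i ` cell p w"
  by (auto simp: cell_def)

lemma vtx_Cons: "vtx p (i # w) j = F p i (vtx p w j)"
  by (simp add: vtx_def)

lemma p_in_cell:
  assumes "equilateral p" "p j \<in> cell p w"
  shows "p j = vtx p w j"
  using assms(2)
proof (induction w)
  case Nil then show ?case by (simp add: vtx_def)
next
  case (Cons k w)
  then have "p j \<in> F p k ` SG p" using cell_subset_SG unfolding cell_Cons by blast
  then have k: "k = j" by (rule p_in_first_cell[OF assms(1)])
  obtain y where "y \<in> cell p w" "p j = F p k y" using Cons.prems unfolding cell_Cons by blast
  then have "p j \<in> cell p w" using F_fixed[of p j] F_inj k by metis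
  then have "p j = vtx p w j" by (rule Cons.IH)
  then show ?case using F_fixed[of p j] k by (simp add: vtx_Cons)
qed

text \<open>Remove the common prefix of the two words: cells whose first letters \<open>i \<noteq> j\<close> differ meet only in
  the junction \<open>F\<^sub>i p\<^sub>j\<close>, and a cell contains \<open>p\<^sub>j\<close> only as its \<open>j\<close>-th corner.\<close>
lemma cells_meet:
  assumes "equilateral p" "length w = length v" "w \<noteq> v" "x \<in> cell p w" "x \<in> cell p v"
  shows "\<exists>i. x = vtx p w i"
  using assms(2-5)
proof (induction w v arbitrary: x rule: list_induct2)
  case (Cons i w j v)
  obtain y z where yz: "y \<in> cell p w" "x = F p i y" "z \<in> cell p v" "x = F p j z"
    using Cons.prems unfolding cell_Cons by blast
  show ?case
  proof (cases "i = j")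
    case True
    then have "y = z" using yz F_inj by metis
    then have "\<exists>k. y = vtx p w k" using Cons.IH Cons.prems True yz by blast
    then show ?thesis using yz by (auto simp: vtx_Cons)
  next
    case False
    have "x = F p i (p j)"
      by (rule first_cells_meet[OF assms(1) False]) (use yz cell_subset_SG in blast)+
    then have "y = p j" using yz F_inj by metis
    then have "y = vtx p w j" using p_in_cell[OF assms(1)] yz(1) by blast
    then show ?thesis using yz by (auto simp: vtx_Cons)
  qed
qed simp

lemma vtx_in_child:
  assumes "equilateral p" "vtx p w k \<in> cell p (w @ [i])"
  shows "k = i"
proof -
  obtain y where y: "y \<in> SG p" "F_word p w (p k) = F_word p w (F p i y)"
    using assms(2) by (auto simp: vtx_def cell_def)
  then have "p k = F p i y" using F_word_dist[of p w "p k" "F p i y"] by simp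
  then show ?thesis using p_in_first_cell[OF assms(1)] y by blast
qed

lemma children_meet:
  assumes "equilateral p" "i \<noteq> j" "x \<in> cell p (w @ [i])" "x \<in> cell p (w @ [j])"
  shows "x = vtx p (w @ [i]) j"
proof -
  obtain y z where yz: "y \<in> SG p" "z \<in> SG p" "x = F_word p w (F p i y)" "x = F_word p w (F p j z)"
    using assms(3,4) by (auto simp: cell_def)
  then have "F p i y = F p j z" using F_word_dist[of p w "F p i y" "F p j z"] by simp
  then have "F p i y = F p i (p j)" using first_cells_meet[OF assms(1,2)] yz by blast
  then show ?thesis using yz by (simp add: vtx_def)
qed

section \<open>Eigenfunctions and their normal derivatives\<close>

text \<open>The multipliers that describe the normal derivatives of a child in terms of those of its parent,
  where \<open>l\<close> belongs to the level of the child.\<close>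
definition rho :: "real \<Rightarrow> real" where
  "rho l = (6 - l) / ((2 - l) * (5 - l))"

definition sg :: "real \<Rightarrow> real" where
  "sg l = rho l / (3 - l)"

text \<open>Up to a factor depending only on the length of \<open>w\<close> this is the outward normal derivative at the
  \<open>i\<close>-th corner of the cell. At a junction of two \<open>m\<close>-cells the eigenvalue equation
  of the graph Laplacian, \<open>\<Sum> (u q - u x) = - lam m * u x\<close>, says that the two values cancel: each cell
  contributes two neighbours and half of the right-hand side.\<close>
definition nder ::
    "(3 \<Rightarrow> real^2) \<Rightarrow> (real^2 \<Rightarrow> real) \<Rightarrow> (nat \<Rightarrow> real) \<Rightarrow> 3 list \<Rightarrow> 3 \<Rightarrow> real" where
  "nder p u lam w i = (3 - lam (length w) / 2) * u (vtx p w i) - (\<Sum>j\<in>UNIV. u (vtx p w j))"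

text \<open>In the next two computations \<open>a, b, c\<close> are the corner values of a cell and \<open>q, r\<close> the values at the
  midpoints next to the corner with value \<open>a\<close>. The parameter of the parent is \<open>l (5 - l)\<close>, and
  everything comes down to the factorisations \<open>6 - l (5 - l) = (2 - l) (3 - l)\<close> and
  \<open>(4 - l)\<^sup>2 - 4 = (2 - l) (6 - l)\<close>.\<close>
lemma extension_derivative_same:
  fixes l :: real
  assumes "l \<noteq> 2" "l \<noteq> 5"
    and q: "q = ((4 - l) * (a + b) + 2 * c) / ((2 - l) * (5 - l))"
    and r: "r = ((4 - l) * (a + c) + 2 * b) / ((2 - l) * (5 - l))"
  shows "(3 - l / 2) * a - (a + q + r) = rho l * ((3 - l * (5 - l) / 2) * a - (a + b + c))"
proof -
  define N where "N = (2 - l) * (5 - l)"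
  have N: "N \<noteq> 0" using assms by (simp add: N_def)
  have qN: "q * N = (4 - l) * (a + b) + 2 * c" and rN: "r * N = (4 - l) * (a + c) + 2 * b"
    using N q r unfolding N_def[symmetric] by simp_all
  have R: "rho l * N = 6 - l" using N by (simp add: rho_def N_def)
  have "((3 - l / 2) * a - (a + q + r)) * N = (2 - l / 2) * a * N - (q * N + r * N)"
    by (simp add: algebra_simps)
  also have "\<dots> = rho l * N * ((3 - l * (5 - l) / 2) * a - (a + b + c))"
    unfolding qN rN R unfolding N_def by (simp add: field_simps)
  finally show ?thesis using N by (simp add: mult.assoc mult.left_commute)
qed

lemma extension_derivative_other:
  fixes l :: real
  assumes "l \<noteq> 2" "l \<noteq> 5" "l \<noteq> 3"
    and q: "q = ((4 - l) * (a + b) + 2 * c) / ((2 - l) * (5 - l))"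
    and r: "r = ((4 - l) * (a + c) + 2 * b) / ((2 - l) * (5 - l))"
  shows "(3 - l / 2) * q - (a + q + r)
     = sg l * ((3 - l * (5 - l) / 2) * b - (a + b + c) - ((3 - l * (5 - l) / 2) * a - (a + b + c)))"
proof -
  define N where "N = (2 - l) * (5 - l)"
  have N: "N \<noteq> 0" using assms by (simp add: N_def)
  have qN: "q * N = (4 - l) * (a + b) + 2 * c" and rN: "r * N = (4 - l) * (a + c) + 2 * b"
    using N q r unfolding N_def[symmetric] by simp_all
  have S: "sg l * N * (3 - l) = 6 - l" using N assms(3) by (simp add: sg_def rho_def N_def)
  have "((3 - l / 2) * q - (a + q + r)) * N = (2 - l / 2) * (q * N) - a * N - r * N"
    by (simp add: algebra_simps)
  also have "\<dots> = (6 - l) * ((2 - l) * (b - a) / 2)"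
    unfolding qN rN unfolding N_def by (simp add: field_simps)
  also have "\<dots> = sg l * N * ((3 - l) * ((2 - l) * (b - a) / 2))"
    unfolding S[symmetric] by simp
  also have "(3 - l) * ((2 - l) * (b - a) / 2) =
      (3 - l * (5 - l) / 2) * b - (a + b + c) - ((3 - l * (5 - l) / 2) * a - (a + b + c))"
    by (simp add: field_simps)
  finally show ?thesis using N by (simp add: mult.assoc mult.left_commute)
qed

text \<open>The function \<open>u\<close> obeys the decimation rule at all levels, and from level \<open>n\<close> on the smaller
  root of \<open>x (5 - x) = lam m\<close> is chosen. The assumptions are symmetric under \<open>u \<mapsto> -u\<close>, so that statements
  about maxima also serve for minima.\<close>
locale decimation =
  fixes p :: "3 \<Rightarrow> real^2" and u :: "real^2 \<Rightarrow> real" and lam :: "nat \<Rightarrow> real" and n :: nat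
  assumes cont: "continuous_on (SG p) u"
    and extension: "\<lbrakk>i \<noteq> j; j \<noteq> k; i \<noteq> k\<rbrakk> \<Longrightarrow> u (vtx p (w @ [i]) j) =
        ((4 - lam (Suc (length w))) * (u (vtx p w i) + u (vtx p w j)) + 2 * u (vtx p w k))
          / ((2 - lam (Suc (length w))) * (5 - lam (Suc (length w))))"
    and lam_step: "lam (Suc m) * (5 - lam (Suc m)) = lam m"
    and lam_pos: "0 < lam m" and lam_less: "lam m < 6"
    and lam_small: "n \<le> m \<Longrightarrow> lam (Suc m) < 2"
begin

abbreviation D where "D \<equiv> nder p u lam"

lemma decimation_uminus: "decimation p (\<lambda>x. - u x) lam n"
proof
  show "continuous_on (SG p) (\<lambda>x. - u x)" by (intro continuous_intros cont)
next
  fix i j k :: 3 and w :: "3 list"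
  assume ijk: "i \<noteq> j" "j \<noteq> k" "i \<noteq> k"
  define l where "l = lam (Suc (length w))"
  show "- u (vtx p (w @ [i]) j) =
        ((4 - lam (Suc (length w))) * (- u (vtx p w i) + - u (vtx p w j)) + 2 * - u (vtx p w k))
          / ((2 - lam (Suc (length w))) * (5 - lam (Suc (length w))))"
    unfolding extension[OF ijk, of w] l_def[symmetric] minus_divide_left
    by (simp add: algebra_simps)
qed (use lam_step lam_pos lam_less lam_small in auto)

lemma nder_uminus: "nder p (\<lambda>x. - u x) lam w i = - D w i"
  by (simp add: nder_def sum_negf)

text \<open>The values \<open>2\<close> and \<open>3\<close> would give \<open>lam m = 6\<close>, and \<open>5\<close> would give \<open>lam m = 0\<close>.\<close>
lemma lam_ne: "lam (Suc m) \<noteq> 2" "lam (Suc m) \<noteq> 3" "lam (Suc m) \<noteq> 5"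
  using lam_step[of m] lam_less[of m] lam_pos[of m] by auto

text \<open>Since \<open>lam < 6\<close>, the corner values of a cell are ordered in the same way as its derivatives.\<close>
lemma D_diff: "D w i - D w j = (3 - lam (length w) / 2) * (u (vtx p w i) - u (vtx p w j))"
  by (simp add: nder_def algebra_simps)

lemma u_less_iff: "u (vtx p w i) < u (vtx p w j) \<longleftrightarrow> D w i < D w j"
proof -
  have "0 < 3 - lam (length w) / 2" using lam_less[of "length w"] by simp
  then show ?thesis using D_diff[of w j i]
    by (metis diff_gt_0_iff_gt zero_less_mult_iff order_less_asym)
qed

lemma u_le_iff: "u (vtx p w i) \<le> u (vtx p w j) \<longleftrightarrow> D w i \<le> D w j"
  using u_less_iff[of w j i] by (simp add: not_less[symmetric])

lemma D_child_same: "D (w @ [i]) i = rho (lam (Suc (length w))) * D w i"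
proof -
  obtain j where j: "i \<noteq> j" by (metis zero_neq_one)
  obtain k where k: "j \<noteq> k" "i \<noteq> k" using third_index[OF j] by blast
  have s: "(\<Sum>x\<in>UNIV. f x) = f i + f j + f k" for f :: "3 \<Rightarrow> real"
    by (rule sum_distinct3) (use j k in auto)
  have k': "k \<noteq> j" using k by simp
  show ?thesis
    unfolding nder_def s vtx_child_same length_append_singleton lam_step[of "length w", symmetric]
    by (rule extension_derivative_same[OF lam_ne(1,3) extension[OF j k] extension[OF k(2) k' j]])
qed

lemma D_child_other:
  assumes j: "i \<noteq> j"
  shows "D (w @ [i]) j = sg (lam (Suc (length w))) * (D w j - D w i)"
proof -
  obtain k where k: "j \<noteq> k" "i \<noteq> k" using third_index[OF j] by blast
  have s: "(\<Sum>x\<in>UNIV. f x) = f i + f j + f k" for f :: "3 \<Rightarrow> real"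
    by (rule sum_distinct3) (use j k in auto)
  have k': "k \<noteq> j" using k by simp
  show ?thesis
    unfolding nder_def s vtx_child_same length_append_singleton lam_step[of "length w", symmetric]
    by (rule extension_derivative_other[OF lam_ne(1,3,2) extension[OF j k] extension[OF k(2) k' j]])
qed

lemma rho_sg_pos:
  assumes "n \<le> m"
  shows "0 < rho (lam (Suc m))" "0 < sg (lam (Suc m))"
  using lam_small[OF assms] by (simp_all add: sg_def rho_def)

lemma rho_sg_ne_0: "rho (lam (Suc m)) \<noteq> 0" "sg (lam (Suc m)) \<noteq> 0"
  using lam_ne[of m] lam_less[of "Suc m"] by (simp_all add: sg_def rho_def)

lemma rho_conv_sg: "rho (lam (Suc m)) = sg (lam (Suc m)) * (3 - lam (Suc m))"
  using lam_ne[of m] by (simp add: sg_def)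

text \<open>The derivatives of a child determine those of the parent.\<close>
lemma D_nonzero_child:
  assumes "D w i \<noteq> 0" shows "\<exists>j. D (w @ [s]) j \<noteq> 0"
proof (rule ccontr)
  assume none: "\<nexists>j. D (w @ [s]) j \<noteq> 0"
  then have "D w s = 0" using D_child_same[of w s] rho_sg_ne_0 by auto
  moreover have "D w i = D w s" if "s \<noteq> i"
    using D_child_other[OF that, of w] none rho_sg_ne_0 by auto
  ultimately show False using assms by auto
qed

lemma D_nonzero:
  assumes "\<exists>i. u (p i) \<noteq> 0" shows "\<exists>i. D w i \<noteq> 0"
proof (induction w rule: rev_induct)
  case Nil
  show ?case
  proof (rule ccontr)
    assume "\<nexists>i. D [] i \<noteq> 0"
    then have 0: "D [] i = 0" for i by simp
    \<comment> \<open>Summing the three equations \<open>D [] i = 0\<close> shows that the sum \<open>s\<close> of the corner values vanishes.\<close>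
    define s where "s = (\<Sum>j\<in>UNIV. u (p j))"
    have *: "(3 - lam 0 / 2) * u (p i) = s" for i using 0[of i] by (simp add: nder_def vtx_def s_def)
    then have "(\<Sum>i\<in>(UNIV::3 set). (3 - lam 0 / 2) * u (p i)) = 3 * s" by simp
    then have "(3 - lam 0 / 2) * s = 3 * s" by (simp add: s_def sum_distrib_left)
    then have "s = 0" using lam_pos[of 0] by (simp add: algebra_simps)
    then show False using * assms lam_less[of 0] by auto
  qed
qed (use D_nonzero_child in blast)

end

section \<open>Local maxima\<close>

definition local_max :: "(3 \<Rightarrow> real^2) \<Rightarrow> (real^2 \<Rightarrow> real) \<Rightarrow> real^2 \<Rightarrow> bool" where
  "local_max p u x \<longleftrightarrow> (\<exists>d>0. \<forall>y\<in>SG p. dist x y < d \<longrightarrow> u y \<le> u x)"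

lemma not_local_maxI:
  assumes "\<And>m. \<exists>v y. m \<le> length v \<and> x \<in> cell p v \<and> y \<in> cell p v \<and> u x < u y"
  shows "\<not> local_max p u x"
proof
  assume "local_max p u x"
  then obtain d where d: "0 < d" "\<And>y. y \<in> SG p \<Longrightarrow> dist x y < d \<Longrightarrow> u y \<le> u x"
    unfolding local_max_def by blast
  obtain m where m: "\<And>w x y. \<lbrakk>m \<le> length w; x \<in> cell p w; y \<in> cell p w\<rbrakk> \<Longrightarrow> dist x y < d"
    using cells_shrink[OF d(1)] by blast
  obtain v y where v: "m \<le> length v" "x \<in> cell p v" "y \<in> cell p v" "u x < u y"
    using assms by blast
  then have "u y \<le> u x" using d(2) m cell_subset_SG by blast
  with v show False by simp
qed

context decimation
begin

abbreviation lmax where "lmax \<equiv> local_max p u"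

text \<open>The situation of a corner \<open>i\<close> from which \<open>u\<close> does not decrease inwards and which is lower than
  corner \<open>j\<close> is inherited by the child at corner \<open>i\<close>, so there are higher points arbitrarily close.\<close>
lemma inflow_vertex_step:
  assumes "n \<le> length w" "D w i \<le> 0" "D w i < D w j"
  shows "D (w @ [i]) i \<le> 0" "D (w @ [i]) i < D (w @ [i]) j"
proof -
  have ij: "i \<noteq> j" using assms by auto
  note pos = rho_sg_pos[OF assms(1)]
  have 1: "D (w @ [i]) i \<le> 0"
    unfolding D_child_same using pos assms(2) by (simp add: mult_nonneg_nonpos)
  moreover have "0 < D (w @ [i]) j"
    unfolding D_child_other[OF ij] using pos assms(3) by simp
  ultimately show "D (w @ [i]) i \<le> 0" "D (w @ [i]) i < D (w @ [i]) j" by auto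
qed

lemma replicate_Suc_append: "w @ replicate (Suc k) i = (w @ replicate k i) @ [i]"
  by (simp add: replicate_append_same)

lemma lower_vertex_not_max:
  assumes "n \<le> length w" "D w i \<le> 0" "D w i < D w j"
  shows "\<not> lmax (vtx p w i)"
proof (rule not_local_maxI)
  fix m
  define v where "v = w @ replicate m i"
  have "D v i \<le> 0 \<and> D v i < D v j" unfolding v_def
  proof (induction m)
    case (Suc m)
    then show ?case unfolding replicate_Suc_append
      by (intro conjI inflow_vertex_step) (use assms(1) in auto)
  qed (use assms in simp)
  then have "u (vtx p v i) < u (vtx p v j)" by (simp add: u_less_iff)
  moreover have "vtx p v i = vtx p w i" by (simp add: v_def vtx_replicate)
  ultimately show "\<exists>v y. m \<le> length v \<and> vtx p w i \<in> cell p v \<and> y \<in> cell p v \<and> u (vtx p w i) < u y"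
    by (intro exI[of _ v] exI[of _ "vtx p v j"]) (metis v_def length_append length_replicate trans_le_add2 order_refl vtx_in_cell)
qed

text \<open>Zoom in at the corner \<open>i\<close>. Let \<open>f > 0\<close> be the inward derivative and \<open>e\<close> the difference of the
  derivatives at \<open>j\<close> and \<open>i\<close>. As long as \<open>e \<le> 0\<close>, each step raises \<open>e / f\<close> by at least \<open>1\<close>, because the
  ratio is first divided by a number \<open>\<ge> 1\<close> and then increased by \<open>1\<close>. So \<open>e\<close> becomes positive.\<close>
lemma inflow_vertex_eventually_lower:
  assumes w: "n \<le> length w" and neg: "D w i < 0"
  obtains k j where "D (w @ replicate k i) i < 0" "D (w @ replicate k i) i < D (w @ replicate k i) j"
proof -
  obtain j where ij: "i \<noteq> j" by (metis zero_neq_one)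
  define v where "v k = w @ replicate k i" for k
  define e where "e k = D (v k) j - D (v k) i" for k
  define f where "f k = - D (v k) i" for k
  define l where "l k = lam (Suc (length (v k)))" for k
  have len: "n \<le> length (v k)" for k using w by (simp add: v_def)
  have v_Suc: "v (Suc k) = v k @ [i]" for k by (simp add: v_def replicate_append_same)
  have pos: "0 < rho (l k)" "0 < sg (l k)" for k
    using rho_sg_pos[OF len] by (simp_all add: l_def)
  have l1: "1 \<le> 3 - l k" for k using lam_small[OF len[of k]] by (simp add: l_def)
  have f_Suc: "f (Suc k) = sg (l k) * (3 - l k) * f k" for k
    by (simp add: f_def v_Suc D_child_same rho_conv_sg l_def)
  have e_Suc: "e (Suc k) = sg (l k) * (e k + (3 - l k) * f k)" for k
    unfolding e_def f_def v_Suc D_child_same D_child_other[OF ij] rho_conv_sg l_def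
    by (simp add: algebra_simps)
  have f_pos: "0 < f k" for k
  proof (induction k)
    case 0 then show ?case using neg by (simp add: f_def v_def)
  next
    case (Suc k) then show ?case unfolding f_Suc using pos[of k] l1[of k] by simp
  qed
  have "\<exists>k. 0 < e k"
  proof (rule ccontr)
    assume "\<not> (\<exists>k. 0 < e k)"
    then have e_le: "e k \<le> 0" for k by (simp add: not_less)
    define c where "c = e 0 / f 0"
    have "(c + real k) * f k \<le> e k" for k
    proof (induction k)
      case 0 then show ?case using f_pos[of 0] by (simp add: c_def)
    next
      case (Suc k)
      have "(c + real k) * f k * (3 - l k) \<le> (c + real k) * f k * 1"
        by (rule mult_left_mono_neg) (use Suc e_le[of k] l1 in auto)
      then have "(c + real (Suc k)) * ((3 - l k) * f k) \<le> e k + (3 - l k) * f k"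
        using Suc by (simp add: algebra_simps)
      then have "sg (l k) * ((c + real (Suc k)) * ((3 - l k) * f k)) \<le> e (Suc k)"
        unfolding e_Suc using pos(2)[of k] by (intro mult_left_mono) auto
      then show ?case unfolding f_Suc by (simp add: mult_ac)
    qed
    moreover obtain k where "- c < real k" using reals_Archimedean2 by blast
    ultimately have "0 < e k" using f_pos[of k]
      by (metis add.commute less_le_trans mult_pos_pos neg_less_iff_less minus_minus real_add_less_0_iff diff_gt_0_iff_gt diff_minus_eq_add)
    then show False using e_le[of k] by simp
  qed
  then obtain k where k: "0 < e k" by blast
  show thesis
    by (rule that[of k j]) (use f_pos[of k] k in \<open>auto simp: e_def f_def v_def\<close>)
qed

lemma inflow_vertex_higher_point:
  assumes "n \<le> length w" "D w i < 0"
  shows "\<exists>y\<in>cell p w. u (vtx p w i) < u y"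
proof -
  obtain k j where "D (w @ replicate k i) i < D (w @ replicate k i) j"
    using inflow_vertex_eventually_lower[OF assms] by blast
  then have "u (vtx p w i) < u (vtx p (w @ replicate k i) j)"
    by (simp add: u_less_iff[symmetric] vtx_replicate)
  then show ?thesis using vtx_in_cell cell_append_subset by blast
qed

lemma inflow_vertex_not_max:
  assumes w: "n \<le> length w" and neg: "D w i < 0"
  shows "\<not> lmax (vtx p w i)"
proof -
  obtain k j where k: "D (w @ replicate k i) i < 0" "D (w @ replicate k i) i < D (w @ replicate k i) j"
    using inflow_vertex_eventually_lower[OF assms] by blast
  have "\<not> lmax (vtx p (w @ replicate k i) i)"
    by (rule lower_vertex_not_max[OF _ less_imp_le[OF k(1)] k(2)]) (use w in simp)
  then show ?thesis by (simp add: vtx_replicate)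
qed

section \<open>The maximum principle\<close>

text \<open>In the child at the top corner the derivative at a midpoint is \<open>\<le> 0\<close> and the one at the corner is
  \<open>\<ge> 0\<close>; the midpoint of the opposite side is compared with another midpoint.\<close>
lemma midpoint_le_top:
  assumes w: "n \<le> length w" and top: "\<And>j. D w j \<le> D w i0" "0 \<le> D w i0"
  shows "u (vtx p (w @ [i]) j) \<le> u (vtx p w i0)"
proof -
  note pos = rho_sg_pos[OF w]
  have A: "u (vtx p (w @ [i0]) k) \<le> u (vtx p w i0)" for k
  proof (cases "k = i0")
    case False
    have "D (w @ [i0]) k \<le> 0"
      unfolding D_child_other[OF False[symmetric]] using pos top by (simp add: mult_nonneg_nonpos)
    also have "0 \<le> D (w @ [i0]) i0" unfolding D_child_same using pos top by simp
    finally show ?thesis using u_le_iff vtx_child_same by metis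
  qed (simp add: vtx_child_same)
  consider "i = i0" | "j = i0" | "i = j" | "i \<noteq> i0" "j \<noteq> i0" "i \<noteq> j" by blast
  then show ?thesis
  proof cases
    case 2 then show ?thesis using A[of i] vtx_child_swap by metis
  next
    case 3 then show ?thesis by (simp add: vtx_child_same u_le_iff top)
  next
    case 4
    have "D (w @ [i]) j \<le> D (w @ [i]) i0"
      unfolding D_child_other[OF 4(1)] D_child_other[OF 4(3)] using pos top by simp
    then have "u (vtx p (w @ [i]) j) \<le> u (vtx p (w @ [i]) i0)" by (simp add: u_le_iff)
    then show ?thesis using A[of i] vtx_child_swap[of p w i i0] by simp
  qed (use A in simp)
qed

lemma top_index: obtains i0 where "\<And>j. D w j \<le> D w i0"
proof -
  obtain i j k where ijk: "i \<noteq> j" "j \<noteq> k" "i \<noteq> k" "D w k \<le> D w j" "D w j \<le> D w i"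
    using ordered_indices[of "D w"] by blast
  have "x = i \<or> x = j \<or> x = k" for x using distinct3_UNIV[OF ijk(1-3)] by blast
  then have "D w x \<le> D w i" for x using ijk by (metis order.trans order.refl)
  then show ?thesis using that by blast
qed

text \<open>The corner with the largest derivative remains a witness, or turns into the midpoint towards it.\<close>
lemma outflow_child:
  assumes w: "n \<le> length w" and "0 \<le> D w i"
  shows "\<exists>j. 0 \<le> D (w @ [s]) j"
proof -
  obtain i0 where top: "\<And>j. D w j \<le> D w i0" using top_index by blast
  have "0 \<le> D (w @ [s]) i0"
  proof (cases "s = i0")
    case True
    have "0 \<le> D w i0" using assms(2) top order_trans by blast
    then show ?thesis using True by (simp add: D_child_same less_imp_le[OF rho_sg_pos(1)[OF w]])
  next
    case False
    then show ?thesis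
      using top[of s] by (simp add: D_child_other less_imp_le[OF rho_sg_pos(2)[OF w]])
  qed
  then show ?thesis by blast
qed

text \<open>The two previous facts carry the bound to the corners of all subcells, and continuity to all
  points.\<close>
lemma maximum_principle:
  assumes w: "n \<le> length w" and out: "0 \<le> D w i"
    and M: "\<And>j. u (vtx p w j) \<le> M" and x: "x \<in> cell p w"
  shows "u x \<le> M"
proof -
  have inv: "(\<exists>i. 0 \<le> D (w @ v) i) \<and> (\<forall>j. u (vtx p (w @ v) j) \<le> M)" for v
  proof (induction v rule: rev_induct)
    case Nil then show ?case using out M by auto
  next
    case (snoc s v)
    have len: "n \<le> length (w @ v)" using w by simp
    obtain i0 where top: "\<And>j. D (w @ v) j \<le> D (w @ v) i0" using top_index by blast
    obtain i where i: "0 \<le> D (w @ v) i" using snoc by blast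
    have "0 \<le> D (w @ v) i0" using top i order_trans by blast
    then have "u (vtx p ((w @ v) @ [s]) j) \<le> M" for j
      using midpoint_le_top[OF len top] snoc order_trans by blast
    then show ?case using outflow_child[OF len i, of s] by (metis append_assoc)
  qed
  have "u x \<in> {..M}"
  proof (rule cells_limit[OF cont closed_atMost])
    fix m
    obtain v where v: "length v = m" "x \<in> cell p (w @ v)" using cell_cover[OF x] by blast
    then show "\<exists>v y. m \<le> length v \<and> x \<in> cell p v \<and> y \<in> cell p v \<and> u y \<in> {..M}"
      by (intro exI[of _ "w @ v"] exI[of _ "vtx p (w @ v) i"]) (use inv vtx_in_cell in auto)
  qed
  then show ?thesis by simp
qed

text \<open>The cells with some derivative \<open>\<ge> 0\<close> for which the maximum principle is strict. Missing are only
  the cells whose largest derivative \<open>0\<close> is attained more than once.\<close>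
definition peaked :: "3 list \<Rightarrow> bool" where
  "peaked w \<longleftrightarrow> (\<exists>i. 0 < D w i) \<or> (\<exists>i. D w i = 0 \<and> (\<forall>j. j \<noteq> i \<longrightarrow> D w j < 0))"

lemma peaked_topE:
  assumes "peaked w"
  obtains i0 where "\<And>j. D w j \<le> D w i0" "0 < D w i0 \<or> D w i0 = 0 \<and> (\<forall>j. j \<noteq> i0 \<longrightarrow> D w j < 0)"
proof -
  obtain i0 where top: "\<And>j. D w j \<le> D w i0" using top_index by blast
  have "0 < D w i0 \<or> D w i0 = 0 \<and> (\<forall>j. j \<noteq> i0 \<longrightarrow> D w j < 0)"
    using assms unfolding peaked_def
  proof
    assume "\<exists>i. 0 < D w i" then show ?thesis using top less_le_trans by blast
  next
    assume "\<exists>i. D w i = 0 \<and> (\<forall>j. j \<noteq> i \<longrightarrow> D w j < 0)"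
    then obtain i where i: "D w i = 0" "\<And>j. j \<noteq> i \<Longrightarrow> D w j < 0" by blast
    then have "i0 = i" using top[of i] by (metis not_less)
    then show ?thesis using i by blast
  qed
  then show ?thesis using that top by blast
qed

lemma peaked_child:
  assumes w: "n \<le> length w" and "peaked w"
  shows "peaked (w @ [s])"
proof -
  note pos = rho_sg_pos[OF w]
  obtain i0 where top: "\<And>j. D w j \<le> D w i0"
    and i0: "0 < D w i0 \<or> D w i0 = 0 \<and> (\<forall>j. j \<noteq> i0 \<longrightarrow> D w j < 0)"
    using peaked_topE[OF assms(2)] by blast
  consider "0 < D w s" | "s \<noteq> i0" "D w s < D w i0" | "s = i0" "D w i0 = 0" "\<And>j. j \<noteq> i0 \<Longrightarrow> D w j < 0"
    using i0 top[of s] by (cases "s = i0") force+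
  then show ?thesis
  proof cases
    case 1
    then have "0 < D (w @ [s]) s" using pos by (simp add: D_child_same)
    then show ?thesis unfolding peaked_def by blast
  next
    case 2
    then have "0 < D (w @ [s]) i0" using pos by (simp add: D_child_other)
    then show ?thesis unfolding peaked_def by blast
  next
    case 3
    have "D (w @ [s]) s = 0" using 3 by (simp add: D_child_same)
    moreover have "D (w @ [s]) j < 0" if "j \<noteq> s" for j
      using that 3 pos by (simp add: D_child_other mult_pos_neg)
    ultimately show ?thesis unfolding peaked_def by blast
  qed
qed

lemma peaked_midpoint_less:
  assumes w: "n \<le> length w" and top: "\<And>j. D w j \<le> D w i0"
    and i0: "0 < D w i0 \<or> D w i0 = 0 \<and> (\<forall>j. j \<noteq> i0 \<longrightarrow> D w j < 0)" and ij: "i \<noteq> j"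
  shows "u (vtx p (w @ [i]) j) < u (vtx p w i0)"
proof -
  note pos = rho_sg_pos[OF w]
  have A: "u (vtx p (w @ [i0]) k) < u (vtx p w i0)" if k: "k \<noteq> i0" for k
  proof -
    have "D (w @ [i0]) k < D (w @ [i0]) i0"
    proof (cases "0 < D w i0")
      case True
      then have "0 < D (w @ [i0]) i0" using pos by (simp add: D_child_same)
      moreover have "D (w @ [i0]) k \<le> 0"
        unfolding D_child_other[OF k[symmetric]] using pos top by (simp add: mult_nonneg_nonpos)
      ultimately show ?thesis by linarith
    next
      case False
      then show ?thesis using i0 k pos
        by (simp add: D_child_same D_child_other[OF k[symmetric]] mult_pos_neg)
    qed
    then show ?thesis using u_less_iff vtx_child_same by metis
  qed
  consider "i = i0" | "j = i0" | "i \<noteq> i0" "j \<noteq> i0" by blast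
  then show ?thesis
  proof cases
    case 2 then show ?thesis using A[of i] ij vtx_child_swap by metis
  next
    case 3
    have "D (w @ [i]) j \<le> D (w @ [i]) i0"
      unfolding D_child_other[OF 3(1)] D_child_other[OF ij] using pos top by simp
    then have "u (vtx p (w @ [i]) j) \<le> u (vtx p (w @ [i]) i0)" by (simp add: u_le_iff)
    then show ?thesis using A[OF 3(1)] vtx_child_swap[of p w i i0] by simp
  qed (use A ij in auto)
qed

lemma peaked_append:
  assumes w: "n \<le> length w" and "peaked w"
  shows "peaked (w @ v)"
proof (induction v rule: rev_induct)
  case (snoc s v)
  then show ?case using peaked_child[of "w @ v" s] w by simp
qed (use assms in simp)

lemma top_value: obtains i0 where "\<And>j. D w j \<le> D w i0" "\<And>j. u (vtx p w j) \<le> u (vtx p w i0)"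
  using top_index u_le_iff by metis

text \<open>A point other than a corner leaves the chain of children at one corner. It then lies in
  a cell all of whose corners are midpoints of earlier cells, and midpoints of peaked cells are strictly
  below the top corner.\<close>
lemma peaked_strict_maximum_principle:
  assumes w: "n \<le> length w" and "peaked w" and x: "x \<in> cell p w" "\<And>i. x \<noteq> vtx p w i"
  shows "\<exists>i. u x < u (vtx p w i)"
proof -
  obtain i0 where top: "\<And>j. D w j \<le> D w i0"
    and i0: "0 < D w i0 \<or> D w i0 = 0 \<and> (\<forall>j. j \<noteq> i0 \<longrightarrow> D w j < 0)"
    using peaked_topE[OF assms(2)] by blast
  define M where "M = u (vtx p w i0)"
  have le_M: "u y \<le> M" if "y \<in> cell p w" for y
    by (rule maximum_principle[OF w, where i = i0]) (use i0 top u_le_iff that in \<open>auto simp: M_def\<close>)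
  have mid: "u (vtx p (w @ v @ [i]) j) < M" if "i \<noteq> j" for v i j
  proof -
    have len: "n \<le> length (w @ v)" using w by simp
    obtain i1 where top1: "\<And>j. D (w @ v) j \<le> D (w @ v) i1"
      and i1: "0 < D (w @ v) i1 \<or> D (w @ v) i1 = 0 \<and> (\<forall>j. j \<noteq> i1 \<longrightarrow> D (w @ v) j < 0)"
      using peaked_topE[OF peaked_append[OF w assms(2)]] by blast
    have "u (vtx p ((w @ v) @ [i]) j) < u (vtx p (w @ v) i1)"
      by (rule peaked_midpoint_less[OF len top1 i1 that])
    also have "\<dots> \<le> M" using le_M vtx_in_cell cell_append_subset by blast
    finally show ?thesis by simp
  qed
  have "u x < M"
  proof (rule ccontr)
    assume not_less: "\<not> u x < M"
    obtain i where i: "x \<in> cell p (w @ [i])" using x(1) cell_children[of p w] by blast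
    have "x \<in> cell p (w @ replicate (Suc k) i)" for k
    proof (induction k)
      case 0 then show ?case using i by simp
    next
      case (Suc k)
      define v where "v = replicate (Suc k) i"
      obtain j where j: "x \<in> cell p (w @ v @ [j])"
        using Suc cell_children[of p "w @ v"] unfolding v_def by auto
      show ?case
      proof (cases "j = i")
        case True
        then show ?thesis using j by (simp add: v_def replicate_append_same)
      next
        case False
        have vert: "u (vtx p (w @ v @ [j]) s) < M" for s
        proof (cases "s = j")
          case True
          have "vtx p (w @ v @ [j]) j = vtx p (w @ v) j"
            using vtx_child_same[of p "w @ v" j] by simp
          also have "\<dots> = vtx p (w @ replicate k i @ [i]) j"
            by (simp add: v_def replicate_append_same)
          finally show ?thesis using mid[of i j "replicate k i"] True False by simp
        qed (use mid in auto)
        define v' where "v' = w @ v @ [j]"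
        have len: "n \<le> length v'" using w by (simp add: v'_def)
        have "peaked v'" unfolding v'_def by (rule peaked_append[OF w assms(2)])
        then obtain i1 where i1: "0 \<le> D v' i1" unfolding peaked_def using less_imp_le order_refl by metis
        obtain i2 where i2: "\<And>j. u (vtx p v' j) \<le> u (vtx p v' i2)" using top_value by blast
        have "u x \<le> u (vtx p v' i2)"
          by (rule maximum_principle[OF len i1 i2]) (use j in \<open>simp add: v'_def\<close>)
        also have "\<dots> < M" using vert by (simp add: v'_def)
        finally show ?thesis using not_less by simp
      qed
    qed
    then have "\<exists>v. m \<le> length v \<and> x \<in> cell p v \<and> vtx p w i \<in> cell p v" for m
      by (intro exI[of _ "w @ replicate (Suc m) i"])
        (metis le_SucI length_append length_replicate trans_le_add2 order_refl vtx_in_cell vtx_replicate)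
    then have "x = vtx p w i" by (rule cells_eqI)
    then show False using x(2) by blast
  qed
  then show ?thesis unfolding M_def by blast
qed

section \<open>Local maxima off the corners\<close>

text \<open>A midpoint is a common corner of two children, where the derivatives \<open>sg * (D j - D i)\<close> and
  \<open>sg * (D i - D j)\<close> are opposite; so \<open>u\<close> increases into one of the two.\<close>
lemma midpoint_not_max_unequal:
  assumes w: "n \<le> length w" and ij: "i \<noteq> j" and ne: "D w i \<noteq> D w j"
  shows "\<not> lmax (vtx p (w @ [i]) j)"
proof -
  have *: "\<not> lmax (vtx p (w @ [a]) b)" if "a \<noteq> b" "D w b < D w a" for a b
  proof (rule inflow_vertex_not_max)
    show "D (w @ [a]) b < 0"
      using that rho_sg_pos[OF w] by (simp add: D_child_other mult_pos_neg)
  qed (use w in simp)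
  show ?thesis
    using *[of i j] *[of j i] ij ne vtx_child_swap[of p w i j] by (metis neqE)
qed

text \<open>Here the derivative at the midpoint vanishes in both children, but some other corner of the child
  is higher, which suffices for a corner with derivative \<open>0\<close>.\<close>
lemma midpoint_not_max_equal:
  assumes w: "n \<le> length w" and ij: "i \<noteq> j" and eq: "D w i = D w j"
    and k: "0 < D w i \<or> D w i < D w k"
  shows "\<not> lmax (vtx p (w @ [i]) j)"
proof -
  note pos = rho_sg_pos[OF w]
  have 0: "D (w @ [i]) j = 0" using eq by (simp add: D_child_other[OF ij])
  from k have "\<exists>s. 0 < D (w @ [i]) s"
  proof
    assume "0 < D w i"
    then have "0 < D (w @ [i]) i" using pos by (simp add: D_child_same)
    then show ?thesis ..
  next
    assume "D w i < D w k"
    then have "0 < D (w @ [i]) k" using pos D_child_other[of i k w] by force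
    then show ?thesis ..
  qed
  then obtain s where "0 < D (w @ [i]) s" ..
  then show ?thesis using lower_vertex_not_max[of "w @ [i]" j s] w 0 by simp
qed

lemma peaked_midpoint_not_max:
  assumes w: "n \<le> length w" and "peaked w" and ij: "i \<noteq> j"
  shows "\<not> lmax (vtx p (w @ [i]) j)"
proof (cases "D w i = D w j")
  case True
  obtain i0 where i0: "\<And>j. D w j \<le> D w i0"
      "0 < D w i0 \<or> D w i0 = 0 \<and> (\<forall>j. j \<noteq> i0 \<longrightarrow> D w j < 0)"
    using peaked_topE[OF assms(2)] by blast
  have "0 < D w i \<or> D w i < D w i0"
    using i0(1)[of i] i0(2) True ij by (metis order_less_le)
  then show ?thesis by (rule midpoint_not_max_equal[OF w ij True])
qed (use midpoint_not_max_unequal[OF w ij] in blast)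

definition interior_max :: "3 list \<Rightarrow> real^2 \<Rightarrow> bool" where
  "interior_max w x \<longleftrightarrow> x \<in> cell p w \<and> (\<forall>i. x \<noteq> vtx p w i) \<and> lmax x"

lemma interior_max_child:
  assumes "interior_max w x"
  obtains s where "interior_max (w @ [s]) x"
    | s j where "s \<noteq> j" "x = vtx p (w @ [s]) j"
proof -
  obtain s where s: "x \<in> cell p (w @ [s])"
    using assms cell_children[of p w] unfolding interior_max_def by blast
  show ?thesis
  proof (cases "\<exists>j. x = vtx p (w @ [s]) j")
    case True
    then obtain j where j: "x = vtx p (w @ [s]) j" by blast
    have "s \<noteq> j" using j assms vtx_child_same unfolding interior_max_def by blast
    then show ?thesis using that(2) j by blast
  next
    case False
    then show ?thesis using that(1)[of s] s assms unfolding interior_max_def by blast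
  qed
qed

text \<open>A point that is never a corner has corners with larger values in arbitrarily small cells; a point
  that becomes a corner first appears as a midpoint of a peaked cell.\<close>
lemma peaked_no_interior_max:
  assumes w: "n \<le> length w" and "peaked w"
  shows "\<not> interior_max w x"
proof
  assume x: "interior_max w x"
  have chain: "\<exists>v. length v = m \<and> interior_max (w @ v) x" for m
  proof (induction m)
    case 0 then show ?case using x by simp
  next
    case (Suc m)
    then obtain v where v: "length v = m" "interior_max (w @ v) x" by blast
    from v(2) obtain s where "interior_max (w @ v @ [s]) x"
    proof (cases rule: interior_max_child)
      case (2 s j)
      have "\<not> lmax x" unfolding 2
        by (rule peaked_midpoint_not_max[OF _ peaked_append[OF assms] 2(1)]) (use w in simp)
      then show ?thesis using x unfolding interior_max_def by blast
    qed (use that in simp)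
    then show ?case using v(1) by (intro exI[of _ "v @ [s]"]) simp
  qed
  have "\<not> lmax x"
  proof (rule not_local_maxI)
    fix m
    obtain v where v: "length v = m" "interior_max (w @ v) x" using chain by blast
    then obtain i where "u x < u (vtx p (w @ v) i)"
      using peaked_strict_maximum_principle[OF _ peaked_append[OF assms]] w
      unfolding interior_max_def by force
    then show "\<exists>v y. m \<le> length v \<and> x \<in> cell p v \<and> y \<in> cell p v \<and> u x < u y"
      by (intro exI[of _ "w @ v"] exI[of _ "vtx p (w @ v) i"])
        (use v vtx_in_cell in \<open>auto simp: interior_max_def\<close>)
  qed
  then show False using x unfolding interior_max_def by blast
qed

lemma zero_edge_child:
  assumes "i \<noteq> j" "D w i = 0" "D w j = 0"
  shows "D (w @ [i]) i = 0" "D (w @ [i]) j = 0" "u (vtx p (w @ [i]) j) = u (vtx p w i)"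
proof -
  show 1: "D (w @ [i]) i = 0" using assms by (simp add: D_child_same)
  show 2: "D (w @ [i]) j = 0" using assms by (simp add: D_child_other)
  show "u (vtx p (w @ [i]) j) = u (vtx p w i)"
    using u_le_iff[of "w @ [i]" i j] u_le_iff[of "w @ [i]" j i] 1 2 vtx_child_same[of p w i] by simp
qed

abbreviation edge where "edge w i j \<equiv> closed_segment (vtx p w i) (vtx p w j)"

lemma edge_split:
  assumes "x \<in> edge w i j"
  obtains s where "s = i \<or> s = j" "x \<in> edge (w @ [s]) i j"
proof -
  have "edge w i j = edge (w @ [i]) i j \<union> edge (w @ [j]) i j"
    unfolding vtx_child_same vtx_child_midpoint midpoint_sym[of "vtx p w j"]
    by (rule Un_closed_segment[symmetric]) simp
  then show ?thesis using assms that by blast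
qed

text \<open>Both children along an edge with vanishing end derivatives inherit this property, and their
  corners on the edge have equal values.\<close>
lemma zero_edge_level:
  assumes ij: "i \<noteq> j" and D: "D w i = 0" "D w j = 0" and x: "x \<in> edge w i j"
  shows "x \<in> SG p" "u x = u (vtx p w i)"
proof -
  define c where "c = u (vtx p w i)"
  have chain: "\<exists>v. length v = m \<and> D (w @ v) i = 0 \<and> D (w @ v) j = 0
      \<and> u (vtx p (w @ v) i) = c \<and> x \<in> edge (w @ v) i j" for m
  proof (induction m)
    case 0 then show ?case using D x by (simp add: c_def)
  next
    case (Suc m)
    then obtain v where v: "length v = m" "D (w @ v) i = 0" "D (w @ v) j = 0"
      "u (vtx p (w @ v) i) = c" "x \<in> edge (w @ v) i j" by blast
    obtain s where s: "s = i \<or> s = j" "x \<in> edge ((w @ v) @ [s]) i j"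
      using edge_split[OF v(5)] by blast
    have ends: "u (vtx p (w @ v) j) = c"
      using u_le_iff[of "w @ v" i j] u_le_iff[of "w @ v" j i] v by simp
    have "D ((w @ v) @ [s]) i = 0 \<and> D ((w @ v) @ [s]) j = 0 \<and> u (vtx p ((w @ v) @ [s]) i) = c"
      using s(1)
    proof
      assume "s = i"
      then show ?thesis using zero_edge_child(1,2)[OF ij v(2,3)] v(4) by (simp only: vtx_child_same)
    next
      assume "s = j"
      then show ?thesis using zero_edge_child[OF ij[symmetric] v(3,2)] ends by simp
    qed
    then show ?case using v(1) s(2) by (intro exI[of _ "v @ [s]"]) auto
  qed
  show "x \<in> SG p" using x edge_subset_cell cell_subset_SG by blast
  have "u x \<in> {c}"
  proof (rule cells_limit[OF cont closed_singleton])
    fix m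
    obtain v where v: "length v = m" "u (vtx p (w @ v) i) = c" "x \<in> edge (w @ v) i j"
      using chain by blast
    then have "x \<in> cell p (w @ v)" using edge_subset_cell by blast
    then show "\<exists>v y. m \<le> length v \<and> x \<in> cell p v \<and> y \<in> cell p v \<and> u y \<in> {c}"
      by (intro exI[of _ "w @ v"] exI[of _ "vtx p (w @ v) i"]) (simp add: v vtx_in_cell)
  qed
  then show "u x = u (vtx p w i)" by (simp add: c_def)
qed

text \<open>The two ways in which a nonzero cell can fail to be peaked: the maximum of \<open>u\<close> is attained along the
  whole edge from \<open>i\<close> to \<open>j\<close>, or \<open>u\<close> increases inwards from all three corners.\<close>
definition ridge :: "3 list \<Rightarrow> 3 \<Rightarrow> 3 \<Rightarrow> bool" where
  "ridge w i j \<longleftrightarrow> i \<noteq> j \<and> D w i = 0 \<and> D w j = 0 \<and> (\<forall>k. k \<noteq> i \<longrightarrow> k \<noteq> j \<longrightarrow> D w k < 0)"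

definition sunk :: "3 list \<Rightarrow> bool" where
  "sunk w \<longleftrightarrow> (\<forall>i. D w i < 0)"

lemma nonzero_trichotomy:
  assumes "\<exists>i. D w i \<noteq> 0"
  shows "peaked w \<or> (\<exists>i j. ridge w i j) \<or> sunk w"
proof -
  obtain i where top: "\<And>j. D w j \<le> D w i" using top_index by blast
  consider "0 < D w i" | "D w i < 0" | "D w i = 0" by linarith
  then show ?thesis
  proof cases
    case 1 then show ?thesis unfolding peaked_def by blast
  next
    case 2 then show ?thesis unfolding sunk_def using top le_less_trans by blast
  next
    case 3
    show ?thesis
    proof (cases "\<exists>j. j \<noteq> i \<and> D w j = 0")
      case True
      then obtain j where j: "i \<noteq> j" "D w j = 0" by metis
      have "D w k < 0" if "k \<noteq> i" "k \<noteq> j" for k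
      proof -
        have "D w k \<noteq> 0"
        proof
          assume "D w k = 0"
          moreover have "x = i \<or> x = j \<or> x = k" for x
            using distinct3_UNIV[of i j k] j(1) that by blast
          ultimately show False using assms 3 j(2) by metis
        qed
        then show ?thesis using top[of k] 3 by simp
      qed
      then show ?thesis using j 3 unfolding ridge_def by blast
    next
      case False
      then show ?thesis using 3 top unfolding peaked_def by (metis order_less_le)
    qed
  qed
qed

lemma ridge_child:
  assumes w: "n \<le> length w" and r: "ridge w i j"
  shows "ridge (w @ [i]) i j"
proof -
  have "D (w @ [i]) k < 0" if "k \<noteq> i" "k \<noteq> j" for k
    using that r rho_sg_pos[OF w] by (simp add: D_child_other ridge_def mult_pos_neg)
  then show ?thesis using zero_edge_child(1,2)[of i j w] r unfolding ridge_def by blast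
qed

lemma ridge_sym: "ridge w i j \<Longrightarrow> ridge w j i"
  by (auto simp: ridge_def)

text \<open>Of the three children the one away from the edge is peaked and the other two are ridges along the
  same edge, so a local maximum is pushed towards the edge.\<close>
lemma ridge_interior_max:
  assumes w: "n \<le> length w" and r: "ridge w i j" and x: "interior_max w x"
  shows "x \<in> edge w i j"
proof (rule ccontr)
  assume no: "x \<notin> edge w i j"
  have chain: "\<exists>v. length v = m \<and> ridge (w @ v) i j \<and> interior_max (w @ v) x
      \<and> vtx p (w @ v) i \<in> edge w i j \<and> vtx p (w @ v) j \<in> edge w i j" for m
  proof (induction m)
    case 0 then show ?case using r x by simp
  next
    case (Suc m)
    then obtain v where v: "length v = m" "ridge (w @ v) i j" "interior_max (w @ v) x"
      "vtx p (w @ v) i \<in> edge w i j" "vtx p (w @ v) j \<in> edge w i j" by blast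
    define v' where "v' = w @ v"
    have len: "n \<le> length v'" using w by (simp add: v'_def)
    note r' = v(2)[folded v'_def]
    have "edge v' i j \<subseteq> edge w i j"
      by (rule closed_segment_subset) (use v in \<open>auto simp: v'_def\<close>)
    then have mid: "midpoint (vtx p v' i) (vtx p v' j) \<in> edge w i j"
      using midpoint_in_closed_segment by blast
    from v(3)[folded v'_def] obtain s where s: "interior_max (v' @ [s]) x"
    proof (cases rule: interior_max_child)
      case (2 s t)
      show ?thesis
      proof (cases "D v' s = D v' t")
        case True
        have third: "r = q" if "r \<noteq> i" "r \<noteq> j" "q \<noteq> i" "q \<noteq> j" for q r
          using that distinct3_UNIV[of i j r] r' unfolding ridge_def by blast
        have neg: "D v' q < 0 \<longleftrightarrow> q \<noteq> i \<and> q \<noteq> j" for q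
          using r' unfolding ridge_def by auto
        have "s = i \<and> t = j \<or> s = j \<and> t = i"
          using third[of s t] True 2(1) neg[of s] neg[of t] by auto
        then have "x \<in> edge w i j" using mid 2(2) by (auto simp: vtx_child_midpoint midpoint_sym)
        then show ?thesis using no by blast
      next
        case False
        then show ?thesis using midpoint_not_max_unequal[OF len 2(1)] 2(2) x
          unfolding interior_max_def by blast
      qed
    qed
    have sij: "s = i \<or> s = j"
    proof (rule ccontr)
      assume s': "\<not> (s = i \<or> s = j)"
      then have "0 < D (v' @ [s]) i"
        using r' rho_sg_pos[OF len] by (simp add: D_child_other ridge_def mult_pos_neg)
      then have "peaked (v' @ [s])" unfolding peaked_def by blast
      then show False using peaked_no_interior_max[of "v' @ [s]"] s len by simp
    qed
    have "ridge (v' @ [s]) i j"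
      using sij ridge_child[OF len] r' ridge_sym by blast
    moreover have "vtx p (v' @ [s]) i \<in> edge w i j" "vtx p (v' @ [s]) j \<in> edge w i j"
      using sij mid v(4,5) unfolding v'_def[symmetric]
      by (auto simp: vtx_child_same vtx_child_midpoint midpoint_sym)
    ultimately show ?case
      using s v(1) unfolding v'_def by (intro exI[of _ "v @ [s]"]) simp
  qed
  have "x \<in> edge w i j"
  proof (rule cells_limit[OF continuous_on_id closed_segment])
    fix m
    obtain v where "length v = m" "interior_max (w @ v) x" "vtx p (w @ v) i \<in> edge w i j"
      using chain by blast
    then show "\<exists>v y. m \<le> length v \<and> x \<in> cell p v \<and> y \<in> cell p v \<and> y \<in> edge w i j"
      by (intro exI[of _ "w @ v"] exI[of _ "vtx p (w @ v) i"])
        (auto simp: interior_max_def vtx_in_cell)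
  qed
  then show False using no by blast
qed

text \<open>The cases are the ties for the largest derivative. If it is attained once, at \<open>s\<close>, then only the
  child \<open>s\<close> is not peaked and it is again sunk. If it is attained twice, all children are peaked and the
  only candidate is the midpoint between the two. If all derivatives agree, every child is a
  ridge along its inner edge, and the three inner edges form a triangle on which \<open>u\<close> is constant.\<close>
lemma sunk_cases:
  assumes w: "n \<le> length w" and sunk: "sunk w"
  shows "(\<exists>s. sunk (w @ [s]) \<and> (\<forall>x. interior_max w x \<longrightarrow> interior_max (w @ [s]) x)) \<or>
    (\<exists>T c. connected T \<and> T \<subseteq> {z \<in> SG p. u z = c} \<and> (\<forall>x. interior_max w x \<longrightarrow> x \<in> T))"
proof -
  note pos = rho_sg_pos[OF w]
  obtain i j k where ijk: "i \<noteq> j" "j \<noteq> k" "i \<noteq> k" "D w k \<le> D w j" "D w j \<le> D w i"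
    using ordered_indices[of "D w"] by blast
  have any: "t = i \<or> t = j \<or> t = k" for t using distinct3_UNIV[OF ijk(1-3)] by blast
  have len: "n \<le> length (w @ [s])" for s using w by simp
  have self: "D (w @ [s]) s < 0" for s
    using sunk pos by (simp add: D_child_same sunk_def mult_pos_neg)
  have mid: "D w s = D w t" if "interior_max w x" "s \<noteq> t" "x = vtx p (w @ [s]) t" for x s t
    using midpoint_not_max_unequal[OF w that(2)] that(1,3) unfolding interior_max_def by blast
  have lower: "\<not> interior_max (w @ [s]) x" if "D w s < D w t" for s t x
  proof -
    have "0 < D (w @ [s]) t" using that pos D_child_other[of s t w] by force
    then show ?thesis using peaked_no_interior_max[OF len] unfolding peaked_def by blast
  qed
  consider "D w j < D w i" | "D w j = D w i" "D w k < D w j" | "D w j = D w i" "D w k = D w j"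
    using ijk by linarith
  then show ?thesis
  proof cases
    case 1
    have less: "D w t < D w i" if "t \<noteq> i" for t
      using any[of t] that 1 ijk by auto
    have "D (w @ [i]) t < 0" for t
      using self[of i] less[of t] pos by (cases "t = i") (simp_all add: D_child_other mult_pos_neg)
    then have "sunk (w @ [i])" by (simp add: sunk_def)
    moreover have "interior_max (w @ [i]) x" if x: "interior_max w x" for x
      using x
    proof (cases rule: interior_max_child)
      case (1 s)
      then show ?thesis using lower[of s i x] less[of s] by (cases "s = i") auto
    next
      case (2 s t)
      have eq: "D w s = D w t" by (rule mid[OF x 2])
      then have "s \<noteq> i" using less[of t] 2(1) by auto
      then have "\<not> lmax x"
        using midpoint_not_max_equal[OF w 2(1) eq, of i] less 2(2) by blast
      then show ?thesis using x unfolding interior_max_def by blast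
    qed
    ultimately show ?thesis by blast
  next
    case 2
    have peak: "peaked (w @ [s])" if "s = i \<and> t = j \<or> s = j \<and> t = i" for s t
    proof -
      have st: "s \<noteq> t" using that ijk by auto
      have "D (w @ [s]) t = 0" using that 2 by (auto simp: D_child_other[OF st])
      moreover have "D (w @ [s]) r < 0" if r: "r \<noteq> t" for r
      proof (cases "r = s")
        case False
        then have "r = k" using any[of r] r that \<open>s = i \<and> t = j \<or> s = j \<and> t = i\<close> by blast
        then have "D w r < D w s" using 2 \<open>s = i \<and> t = j \<or> s = j \<and> t = i\<close> by auto
        then show ?thesis using False pos by (simp add: D_child_other[of s r] mult_pos_neg)
      qed (use self in simp)
      ultimately show ?thesis unfolding peaked_def by blast
    qed
    have "x = vtx p (w @ [i]) j" if x: "interior_max w x" for x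
      using x
    proof (cases rule: interior_max_child)
      case (1 s)
      have "\<not> interior_max (w @ [s]) x"
        using any[of s] peak[of i j] peak[of j i] peaked_no_interior_max[OF len] lower[of k i] 2
        by metis
      then show ?thesis using 1 by blast
    next
      case (2 s t)
      have "D w s = D w t" by (rule mid[OF x 2])
      then have "s = i \<and> t = j \<or> s = j \<and> t = i"
        using any[of s] any[of t] 2(1) \<open>D w j = D w i\<close> \<open>D w k < D w j\<close> by auto
      then show ?thesis using 2(2) vtx_child_swap by metis
    qed
    then show ?thesis
      by (intro disjI2 exI[of _ "{vtx p (w @ [i]) j}"] exI[of _ "u (vtx p (w @ [i]) j)"])
        (auto simp: vtx_in_SG)
  next
    case 3
    have eq: "D w s = D w t" for s t using any[of s] any[of t] 3 by auto
    have zero: "D (w @ [s]) t = 0" if "s \<noteq> t" for s t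
      using D_child_other[OF that, of w] eq[of s t] by simp
    have r: "ridge (w @ [s]) a b" if "s \<noteq> a" "s \<noteq> b" "a \<noteq> b" for s a b
    proof -
      have "t = s" if "t \<noteq> a" "t \<noteq> b" for t
        using distinct3_UNIV[of s a b] \<open>s \<noteq> a\<close> \<open>s \<noteq> b\<close> \<open>a \<noteq> b\<close> that by blast
      then show ?thesis using that zero self unfolding ridge_def by blast
    qed
    have level: "y \<in> SG p \<and> u y = u (vtx p (w @ [s]) a)"
      if "y \<in> edge (w @ [s]) a b" "s \<noteq> a" "s \<noteq> b" "a \<noteq> b" for y s a b
      using zero_edge_level[of a b "w @ [s]" y] zero that by blast
    define c where "c = u (vtx p (w @ [i]) j)"
    have c: "u (vtx p (w @ [j]) i) = c" "u (vtx p (w @ [k]) i) = c"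
    proof -
      show "u (vtx p (w @ [j]) i) = c" using vtx_child_swap[of p w i j] by (simp add: c_def)
      have "u (vtx p (w @ [i]) k) = u (vtx p (w @ [i]) j)"
        using level[of "vtx p (w @ [i]) k" i j k] ijk by auto
      then show "u (vtx p (w @ [k]) i) = c" using vtx_child_swap[of p w i k] by (simp add: c_def)
    qed
    define T where "T = edge (w @ [i]) j k \<union> edge (w @ [j]) i k \<union> edge (w @ [k]) i j"
    have "connected T" unfolding T_def
    proof (intro connected_Un connected_segment)
      show "edge (w @ [i]) j k \<inter> edge (w @ [j]) i k \<noteq> {}"
        using ends_in_segment(1)[of "vtx p (w @ [i]) j"] ends_in_segment(1)[of "vtx p (w @ [j]) i"]
        unfolding vtx_child_swap[of p w i j] by blast
      show "(edge (w @ [i]) j k \<union> edge (w @ [j]) i k) \<inter> edge (w @ [k]) i j \<noteq> {}"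
        using ends_in_segment(2)[of "vtx p (w @ [i]) k"] ends_in_segment(1)[of "vtx p (w @ [k]) i"]
        unfolding vtx_child_swap[of p w i k] by blast
    qed
    moreover have "T \<subseteq> {z \<in> SG p. u z = c}"
      using level[of _ i j k] level[of _ j i k] level[of _ k i j] c ijk(1-3)
      unfolding T_def c_def[symmetric] by auto
    moreover have "x \<in> T" if x: "interior_max w x" for x
      using x
    proof (cases rule: interior_max_child)
      case (1 s)
      have e: "x \<in> edge (w @ [s]) a b" if "s \<noteq> a" "s \<noteq> b" "a \<noteq> b" for a b
        by (rule ridge_interior_max[OF len r[OF that] 1])
      from any[of s] show ?thesis
        using e[of j k] e[of i k] e[of i j] ijk(1-3) unfolding T_def by auto
    next
      case (2 s t)
      from any[of s] any[of t] 2(1) show ?thesis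
        unfolding T_def 2(2) by auto
    qed
    ultimately show ?thesis by blast
  qed
qed

text \<open>Either the recursion of \<open>sunk_cases\<close> stops in a connected level set, or it never stops and squeezes
  all local maxima into one point.\<close>
lemma sunk_interior_max_joined:
  assumes w: "n \<le> length w" and sunk: "sunk w" and x: "interior_max w x" and y: "interior_max w y"
  shows "\<exists>T c. connected T \<and> T \<subseteq> {z \<in> SG p. u z = c} \<and> x \<in> T \<and> y \<in> T"
proof (rule ccontr)
  assume no: "\<not> ?thesis"
  have chain: "\<exists>v. length v = m \<and> sunk (w @ v) \<and> interior_max (w @ v) x \<and> interior_max (w @ v) y" for m
  proof (induction m)
    case 0 show ?case by (intro exI[of _ "[]"]) (simp add: sunk x y)
  next
    case (Suc m)
    then obtain v where v: "length v = m" "sunk (w @ v)" "interior_max (w @ v) x" "interior_max (w @ v) y"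
      by blast
    have len: "n \<le> length (w @ v)" using w by simp
    obtain s where "sunk ((w @ v) @ [s])" "interior_max ((w @ v) @ [s]) x" "interior_max ((w @ v) @ [s]) y"
      using sunk_cases[OF len v(2)]
    proof
      assume "\<exists>s. sunk ((w @ v) @ [s]) \<and>
        (\<forall>x. interior_max (w @ v) x \<longrightarrow> interior_max ((w @ v) @ [s]) x)"
      then show ?thesis using that v(3,4) by blast
    next
      assume "\<exists>T c. connected T \<and> T \<subseteq> {z \<in> SG p. u z = c} \<and> (\<forall>x. interior_max (w @ v) x \<longrightarrow> x \<in> T)"
      then obtain T c where "connected T" "T \<subseteq> {z \<in> SG p. u z = c}" "x \<in> T" "y \<in> T"
        using v(3,4) by blast
      then show ?thesis using no by blast
    qed
    then show ?case using v(1) by (intro exI[of _ "v @ [s]"]) simp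
  qed
  have "\<exists>v. m \<le> length v \<and> x \<in> cell p v \<and> y \<in> cell p v" for m
  proof -
    obtain v where "length v = m" "interior_max (w @ v) x" "interior_max (w @ v) y"
      using chain by blast
    then show ?thesis unfolding interior_max_def by (intro exI[of _ "w @ v"]) simp
  qed
  then have "x = y" by (rule cells_eqI)
  moreover have "x \<in> SG p" using x cell_subset_SG unfolding interior_max_def by blast
  ultimately have "connected {x} \<and> {x} \<subseteq> {z \<in> SG p. u z = u x} \<and> x \<in> {x} \<and> y \<in> {x}" by auto
  then show False using no by blast
qed

lemma component_eqI:
  assumes A: "A \<in> components {x \<in> SG p. u x = a}" and B: "B \<in> components {x \<in> SG p. u x = b}"
    and T: "connected T" "T \<subseteq> {z \<in> SG p. u z = c}" "x \<in> T" "y \<in> T" "x \<in> A" "y \<in> B"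
  shows "A = B" "T \<subseteq> A"
proof -
  have "u x = a" "u y = b" using in_components_subset[OF A] in_components_subset[OF B] T(5,6) by auto
  then have ab: "a = c" "b = c" using T(2-4) by auto
  show TA: "T \<subseteq> A" using components_maximal[OF A T(1)] T(2,3,5) ab by blast
  moreover have "T \<subseteq> B" using components_maximal[OF B T(1)] T(2,4,6) ab by blast
  ultimately have "A \<inter> B \<noteq> {}" using T(3) by blast
  then show "A = B" using components_nonoverlap[OF A[unfolded ab] B[unfolded ab]] by blast
qed

text \<open>A plateau of local maxima that avoids the corners cannot meet a peaked cell, nor a ridge, whose
  edge would connect it to a corner. In the remaining case two such plateaus are joined inside a
  level set, so they are equal.\<close>
lemma max_component_unique:
  assumes nz: "\<exists>i. D w i \<noteq> 0" and w: "n \<le> length w"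
    and A: "A \<in> components {x \<in> SG p. u x = a}" "\<And>x. x \<in> A \<Longrightarrow> lmax x" "\<And>i. vtx p w i \<notin> A"
      "x \<in> A" "x \<in> cell p w"
  shows "sunk w"
    and "\<lbrakk>B \<in> components {x \<in> SG p. u x = b}; \<And>x. x \<in> B \<Longrightarrow> lmax x; \<And>i. vtx p w i \<notin> B;
      y \<in> B; y \<in> cell p w\<rbrakk> \<Longrightarrow> A = B"
proof -
  have x: "interior_max w x" using A unfolding interior_max_def by blast
  have "\<not> ridge w i j" for i j
  proof
    assume r: "ridge w i j"
    then have e: "x \<in> edge w i j" by (rule ridge_interior_max[OF w _ x])
    have "edge w i j \<subseteq> {z \<in> SG p. u z = u (vtx p w i)}"
      using zero_edge_level[of i j w] r unfolding ridge_def by blast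
    then have "edge w i j \<subseteq> A"
      by (rule component_eqI(2)[OF A(1,1) connected_segment(1) _ e e A(4,4)])
    then show False using A(3) ends_in_segment by blast
  qed
  then show sunk: "sunk w"
    using nonzero_trichotomy[OF nz] peaked_no_interior_max[OF w] x by blast
  assume B: "B \<in> components {x \<in> SG p. u x = b}" "\<And>x. x \<in> B \<Longrightarrow> lmax x" "\<And>i. vtx p w i \<notin> B"
    "y \<in> B" "y \<in> cell p w"
  then have "interior_max w y" unfolding interior_max_def by blast
  then obtain T c where "connected T" "T \<subseteq> {z \<in> SG p. u z = c}" "x \<in> T" "y \<in> T"
    using sunk_interior_max_joined[OF w sunk x] by blast
  then show "A = B" using component_eqI(1)[OF A(1) B(1)] A(4) B(4) by blast
qed

end

section \<open>Counting extreme sets from above\<close>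

lemma Extr_uminus: "Extr p (\<lambda>x. - u x) = Extr p u"
proof -
  have *: "extreme_set p v A" if ext: "extreme_set p (\<lambda>x. - v x) A" for v :: "real^2 \<Rightarrow> real" and A
  proof -
    obtain c d where c: "A \<in> components {x \<in> SG p. - v x = c}" "A \<inter> V0 p = {}" "d > 0"
      "(\<forall>x\<in>nbhd_SG p A d. - v x \<le> c) \<or> (\<forall>x\<in>nbhd_SG p A d. c \<le> - v x)"
      using ext unfolding extreme_set_def by blast
    have "{x \<in> SG p. - v x = c} = {x \<in> SG p. v x = - c}" by auto
    moreover have "(\<forall>x\<in>nbhd_SG p A d. v x \<le> - c) \<or> (\<forall>x\<in>nbhd_SG p A d. - c \<le> v x)"
      using c(4) by force
    ultimately show ?thesis unfolding extreme_set_def using c(1-3)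
      by (intro exI[of _ "- c"] conjI exI[of _ d]) auto
  qed
  from *[of u] *[of "\<lambda>x. - u x"] show ?thesis unfolding Extr_def by auto
qed

context decimation
begin

lemma extreme_set_local:
  assumes "A \<in> Extr p u"
  obtains c where "A \<in> components {x \<in> SG p. u x = c}"
    "(\<forall>x\<in>A. local_max p u x) \<or> (\<forall>x\<in>A. local_max p (\<lambda>x. - u x) x)"
proof -
  obtain c d where A: "A \<in> components {x \<in> SG p. u x = c}" "d > 0"
    and d: "(\<forall>x\<in>nbhd_SG p A d. u x \<le> c) \<or> (\<forall>x\<in>nbhd_SG p A d. c \<le> u x)"
    using assms unfolding Extr_def extreme_set_def by auto
  have near: "y \<in> nbhd_SG p A d" if "x \<in> A" "y \<in> SG p" "dist x y < d" for x y
    using that unfolding nbhd_SG_def by (auto simp: dist_commute)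
  have val: "u x = c" if "x \<in> A" for x using in_components_subset[OF A(1)] that by blast
  have "(\<forall>x\<in>A. local_max p u x) \<or> (\<forall>x\<in>A. local_max p (\<lambda>x. - u x) x)"
    using d
  proof
    assume "\<forall>x\<in>nbhd_SG p A d. u x \<le> c"
    then have "\<forall>x\<in>A. local_max p u x"
      unfolding local_max_def using near val A(2) by metis
    then show ?thesis ..
  next
    assume "\<forall>x\<in>nbhd_SG p A d. c \<le> u x"
    then have "\<forall>x\<in>A. local_max p (\<lambda>x. - u x) x"
      unfolding local_max_def using near val A(2) neg_le_iff_le by metis
    then show ?thesis ..
  qed
  then show ?thesis using that A(1) by blast
qed

lemma extreme_set_in_cell_unique:
  assumes nz: "\<exists>i. D w i \<noteq> 0" and w: "n \<le> length w"
    and A: "A \<in> Extr p u" "\<And>i. vtx p w i \<notin> A" "x \<in> A" "x \<in> cell p w"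
    and B: "B \<in> Extr p u" "\<And>i. vtx p w i \<notin> B" "y \<in> B" "y \<in> cell p w"
  shows "A = B"
proof -
  interpret neg: decimation p "\<lambda>x. - u x" lam n by (rule decimation_uminus)
  have nz': "\<exists>i. neg.D w i \<noteq> 0" using nz by (simp add: nder_uminus)
  obtain a where a: "A \<in> components {x \<in> SG p. u x = a}"
    and amm: "(\<forall>x\<in>A. local_max p u x) \<or> (\<forall>x\<in>A. local_max p (\<lambda>x. - u x) x)"
    using extreme_set_local[OF A(1)] by blast
  obtain b where b: "B \<in> components {x \<in> SG p. u x = b}"
    and bmm: "(\<forall>x\<in>B. local_max p u x) \<or> (\<forall>x\<in>B. local_max p (\<lambda>x. - u x) x)"
    using extreme_set_local[OF B(1)] by blast
  have eq: "{x \<in> SG p. u x = c} = {x \<in> SG p. - u x = - c}" for c by auto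
  note a' = a[unfolded eq] and b' = b[unfolded eq]
  have excl: "\<not> (sunk w \<and> neg.sunk w)"
    unfolding sunk_def neg.sunk_def nder_uminus
    by (metis neg_less_0_iff_less order_less_asym)
  consider "\<forall>x\<in>A. local_max p u x" "\<forall>x\<in>B. local_max p u x"
    | "\<forall>x\<in>A. local_max p (\<lambda>x. - u x) x" "\<forall>x\<in>B. local_max p (\<lambda>x. - u x) x"
    | "\<forall>x\<in>A. local_max p u x" "\<forall>x\<in>B. local_max p (\<lambda>x. - u x) x"
    | "\<forall>x\<in>A. local_max p (\<lambda>x. - u x) x" "\<forall>x\<in>B. local_max p u x"
    using amm bmm by blast
  then show ?thesis
  proof cases
    case 1
    show ?thesis
      by (rule max_component_unique(2)[OF nz w a _ A(2-4) b _ B(2-4)]) (use 1 in auto)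
  next
    case 2
    show ?thesis
      by (rule neg.max_component_unique(2)[OF nz' w a' _ A(2-4) b' _ B(2-4)]) (use 2 in auto)
  next
    case 3
    have "sunk w" by (rule max_component_unique(1)[OF nz w a _ A(2-4)]) (use 3 in auto)
    moreover have "neg.sunk w"
      by (rule neg.max_component_unique(1)[OF nz' w b' _ B(2-4)]) (use 3 in auto)
    ultimately show ?thesis using excl by blast
  next
    case 4
    have "sunk w" by (rule max_component_unique(1)[OF nz w b _ B(2-4)]) (use 4 in auto)
    moreover have "neg.sunk w"
      by (rule neg.max_component_unique(1)[OF nz' w a' _ A(2-4)]) (use 4 in auto)
    ultimately show ?thesis using excl by blast
  qed
qed

text \<open>An extreme set containing a corner of an \<open>n\<close>-cell is determined by this corner (at most \<open>3 \<cdot> 3\<^sup>n\<close>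
  sets), and any other one by an \<open>n\<close>-cell that it meets (at most \<open>3\<^sup>n\<close> sets).\<close>
theorem Extr_upper_bound:
  assumes "\<exists>i. u (p i) \<noteq> 0"
  shows "finite (Extr p u)" "card (Extr p u) \<le> 4 * 3 ^ n"
proof -
  define W where "W = {w :: 3 list. length w = n}"
  define comp where "comp = (\<lambda>(w, i). connected_component_set {x \<in> SG p. u x = u (vtx p w i)} (vtx p w i))"
  define inner where "inner w A \<longleftrightarrow> A \<in> Extr p u \<and> (\<forall>i. vtx p w i \<notin> A) \<and> A \<inter> cell p w \<noteq> {}" for w A
  define pick where "pick w = (SOME A. inner w A)" for w
  have finW: "finite W" and cardW: "card W = 3 ^ n"
    unfolding W_def by (rule finite_words card_words)+
  have sub: "Extr p u \<subseteq> comp ` (W \<times> UNIV) \<union> pick ` W"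
  proof
    fix A assume A: "A \<in> Extr p u"
    then obtain c where c: "A \<in> components {x \<in> SG p. u x = c}"
      unfolding Extr_def extreme_set_def by blast
    show "A \<in> comp ` (W \<times> UNIV) \<union> pick ` W"
    proof (cases "\<exists>w\<in>W. \<exists>i. vtx p w i \<in> A")
      case True
      then obtain w i where wi: "w \<in> W" "vtx p w i \<in> A" by blast
      then have "u (vtx p w i) = c" using in_components_subset[OF c] by blast
      then obtain x0 where x0: "A = connected_component_set {x \<in> SG p. u x = u (vtx p w i)} x0"
        using c by (auto elim: componentsE)
      have "A = comp (w, i)"
        using connected_component_eq[OF wi(2)[unfolded x0]] by (simp add: comp_def x0)
      then show ?thesis using wi(1) by blast
    next
      case False
      obtain x where x: "x \<in> A" "x \<in> SG p"
        using in_components_nonempty[OF c] in_components_subset[OF c] by blast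
      then have "x \<in> cell p []" by simp
      then obtain w where w: "length w = n" "x \<in> cell p ([] @ w)" using cell_cover by blast
      have "inner w A" unfolding inner_def using False A x w by (auto simp: W_def)
      moreover have "B = A" if "inner w B" for B
      proof -
        obtain y where "y \<in> B" "y \<in> cell p w" using \<open>inner w B\<close> unfolding inner_def by blast
        then show ?thesis
          using extreme_set_in_cell_unique[OF D_nonzero[OF assms], of w B y A x] w x \<open>inner w A\<close> that
          unfolding inner_def by simp
      qed
      ultimately have "pick w = A" unfolding pick_def by (rule some_equality)
      then show ?thesis using w by (auto simp: W_def)
    qed
  qed
  have fin: "finite (comp ` (W \<times> UNIV) \<union> pick ` W)" using finW by simp
  then show "finite (Extr p u)" using sub finite_subset by blast
  have "card (Extr p u) \<le> card (comp ` (W \<times> UNIV) \<union> pick ` W)" by (rule card_mono[OF fin sub])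
  also have "\<dots> \<le> card (comp ` (W \<times> UNIV)) + card (pick ` W)" by (rule card_Un_le)
  also have "\<dots> \<le> card (W \<times> (UNIV :: 3 set)) + card W"
    by (intro add_mono card_image_le) (use finW in auto)
  also have "\<dots> = 4 * 3 ^ n" by (simp add: card_cartesian_product cardW)
  finally show "card (Extr p u) \<le> 4 * 3 ^ n" .
qed

end

section \<open>Counting extreme sets from below\<close>

text \<open>The set \<open>B\<close> plays the role of the boundary of \<open>U\<close> in the gasket, and \<open>C\<close> is the closed rest. As the
  minimum \<open>c\<close> over \<open>U\<close> is not attained on \<open>B\<close>, the part of the level set in \<open>U\<close> is separated from \<open>C\<close>.\<close>
lemma min_component_extreme:
  assumes cont: "continuous_on (SG p) u" and U: "compact U" "U \<subseteq> SG p"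
    and C: "closed C" "SG p \<subseteq> U \<union> C" "U \<inter> C \<subseteq> B" "V0 p \<inter> U \<subseteq> B"
    and x0: "x0 \<in> U" "u x0 = c" "\<And>x. x \<in> U \<Longrightarrow> c \<le> u x" "\<And>x. x \<in> B \<Longrightarrow> u x \<noteq> c"
  shows "\<exists>A\<in>Extr p u. x0 \<in> A \<and> A \<subseteq> U - B"
proof -
  define Z where "Z = {x \<in> U. u x = c}"
  define L where "L = {x \<in> SG p. u x = c}"
  define A where "A = connected_component_set L x0"
  have "closedin (top_of_set U) {x \<in> U. u x = c}"
    by (rule continuous_closedin_preimage_constant[OF continuous_on_subset[OF cont U(2)]])
  then have Z: "compact Z" unfolding Z_def using U(1) closedin_compact by blast
  have disj: "Z \<inter> C = {}" using C(3) x0(4) unfolding Z_def by blast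
  have x0L: "x0 \<in> L" using x0 U unfolding L_def by blast
  then have x0A: "x0 \<in> A" unfolding A_def by simp
  have AL: "A \<subseteq> L" unfolding A_def by (rule connected_component_subset)
  have comp: "A \<in> components L" unfolding A_def using x0L by (rule componentsI)
  have "A \<subseteq> Z \<union> C" using AL C(2) unfolding L_def Z_def by blast
  moreover have "connected A" unfolding A_def by simp
  moreover have "Z \<inter> A \<noteq> {}" using x0A x0 unfolding Z_def by blast
  ultimately have "C \<inter> A = {}"
    using connected_closedD[of A Z C] disj Z C(1) compact_imp_closed by blast
  then have AZ: "A \<subseteq> Z" using \<open>A \<subseteq> Z \<union> C\<close> by blast
  then have AB: "A \<subseteq> U - B" using x0(4) unfolding Z_def by blast
  obtain d where d: "d > 0" "\<And>x y. x \<in> Z \<Longrightarrow> y \<in> C \<Longrightarrow> d \<le> dist x y"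
    using separate_compact_closed[OF Z C(1) disj] by blast
  have "c \<le> u y" if y: "y \<in> nbhd_SG p A d" for y
  proof -
    obtain x where "x \<in> A" "y \<in> SG p" "dist y x < d" using y unfolding nbhd_SG_def by blast
    then have "y \<notin> C" using d(2)[of x y] AZ by (auto simp: dist_commute)
    then show ?thesis using x0(3) C(2) \<open>y \<in> SG p\<close> by blast
  qed
  then have "A \<in> Extr p u"
    unfolding Extr_def extreme_set_def mem_Collect_eq
    using comp[unfolded L_def] AB C(4) d(1) by (intro exI[of _ c] conjI exI[of _ d]) auto
  then show ?thesis using x0A AB by blast
qed

context decimation
begin

text \<open>The minimum is taken over the union \<open>U\<close> of the children at the corners with the least derivative.
  Taking just one of them would not do: where two such children meet, the derivative vanishes
  and the extreme set may pass through.\<close>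
lemma cell_contains_min:
  assumes eq: "equilateral p" and w: "Suc (length w) = n" and ln: "3 < lam n"
    and neg: "D w k < 0"
  shows "\<exists>A\<in>Extr p u. A \<noteq> {} \<and> A \<subseteq> cell p w \<and> (\<forall>i. vtx p w i \<notin> A)"
proof -
  define c0 where "c0 = Min (range (D w))"
  have c0: "c0 \<le> D w i" for i unfolding c0_def by (rule Min_le) auto
  then have c0_neg: "c0 < 0" using neg le_less_trans by blast
  have "c0 \<in> range (D w)" unfolding c0_def by (rule Min_in) auto
  then obtain i0 where i0: "D w i0 = c0" by blast
  define T where "T = {i. D w i = c0}"
  define U where "U = (\<Union>i\<in>T. cell p (w @ [i]))"
  define B where "B = {vtx p (w @ [i]) j | i j. i \<in> T \<and> (j = i \<or> j \<notin> T)}"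
  define C where "C = (\<Union>v\<in>{v. length v = n \<and> v \<notin> (\<lambda>i. w @ [i]) ` T}. cell p v)"
  have lam: "lam n < 5" using lam_step[of "length w"] lam_pos w
    by (metis diff_gt_0_iff_gt zero_less_mult_pos)
  \<comment> \<open>The larger root at level \<open>n\<close> reverses the sign of the derivative at an old corner, but not that of
    the differences at the midpoints.\<close>
  have rho: "rho (lam (Suc (length w))) < 0"
    unfolding w rho_def using ln lam by (intro divide_pos_neg mult_neg_pos) auto
  then have sg: "0 < sg (lam (Suc (length w)))"
    unfolding sg_def using ln w by (intro divide_neg_neg) auto
  interpret neg: decimation p "\<lambda>x. - u x" lam n by (rule decimation_uminus)
  have U: "compact U" "U \<subseteq> SG p"
    unfolding U_def using cell_subset_SG by (auto intro!: compact_UN cell_compact)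
  have "closed C" unfolding C_def
  proof (intro closed_UN ballI)
    show "finite {v. length v = n \<and> v \<notin> (\<lambda>i. w @ [i]) ` T}"
      by (rule finite_subset[OF _ finite_words[of n]]) auto
  qed (use cell_compact compact_imp_closed in blast)
  moreover have "SG p \<subseteq> U \<union> C"
  proof
    fix x assume "x \<in> SG p"
    then have "x \<in> cell p []" by simp
    then obtain v where "length v = n" "x \<in> cell p ([] @ v)" using cell_cover by blast
    then show "x \<in> U \<union> C" unfolding U_def C_def by auto
  qed
  moreover have corner: "vtx p w k \<in> B" if k: "vtx p w k \<in> U" for k
  proof -
    obtain i where i: "i \<in> T" "vtx p w k \<in> cell p (w @ [i])" using k unfolding U_def by blast
    then have "k = i" using vtx_in_child[OF eq] by blast
    then have "vtx p w k = vtx p (w @ [i]) i" by (simp add: vtx_child_same)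
    then show ?thesis using i(1) unfolding B_def by blast
  qed
  moreover have "U \<inter> C \<subseteq> B"
  proof
    fix x assume x: "x \<in> U \<inter> C"
    then obtain i where i: "i \<in> T" "x \<in> cell p (w @ [i])" unfolding U_def by blast
    obtain v where v: "length v = n" "v \<notin> (\<lambda>i. w @ [i]) ` T" "x \<in> cell p v"
      using x unfolding C_def by blast
    have "v \<noteq> []" using v(1) w by auto
    then obtain v' j where v': "v = v' @ [j]" by (metis rev_exhaust)
    show "x \<in> B"
    proof (cases "v' = w")
      case True
      then have j: "j \<notin> T" using v v' by blast
      then have "x = vtx p (w @ [i]) j"
        using children_meet[OF eq _ i(2), of j] i(1) v(3) v' True by auto
      then show ?thesis using i(1) j unfolding B_def by blast
    next
      case False
      have "\<exists>k. x = vtx p w k"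
      proof (rule cells_meet[OF eq])
        show "length w = length v'" using v(1) v' w by simp
        show "x \<in> cell p w" "x \<in> cell p v'" using i(2) v(3) v' cell_child_subset by blast+
      qed (use False in simp)
      then show ?thesis using corner x by blast
    qed
  qed
  moreover have "V0 p \<inter> U \<subseteq> B"
  proof
    fix x assume "x \<in> V0 p \<inter> U"
    then obtain j where j: "x = p j" "p j \<in> U" unfolding V0_def by blast
    then have "p j \<in> cell p w" unfolding U_def using cell_child_subset by blast
    then have "p j = vtx p w j" by (rule p_in_cell[OF eq])
    then show "x \<in> B" using corner j by metis
  qed
  moreover have "U \<noteq> {}" unfolding U_def using i0 vtx_in_cell by (force simp: T_def)
  then obtain x0 where x0: "x0 \<in> U" "\<And>x. x \<in> U \<Longrightarrow> u x0 \<le> u x"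
    using continuous_attains_inf[OF U(1) _ continuous_on_subset[OF cont U(2)]] by blast
  moreover have "u x \<noteq> u x0" if "x \<in> B" for x
  proof -
    obtain i j where ij: "x = vtx p (w @ [i]) j" "i \<in> T" "j = i \<or> j \<notin> T"
      using \<open>x \<in> B\<close> unfolding B_def by blast
    have Di: "D w i = c0" using ij(2) unfolding T_def by simp
    have "0 < D (w @ [i]) j"
    proof (cases "j = i")
      case True
      then show ?thesis using rho c0_neg Di by (simp add: D_child_same mult_neg_neg)
    next
      case False
      then have "c0 < D w j" using ij(3) c0[of j] unfolding T_def by auto
      then show ?thesis using False sg Di by (simp add: D_child_other)
    qed
    then have "neg.D (w @ [i]) j < 0" by (simp add: nder_uminus)
    then obtain y where "y \<in> cell p (w @ [i])" "- u x < - u y"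
      using neg.inflow_vertex_higher_point[of "w @ [i]" j] w ij(1) by auto
    then have "y \<in> U" "u y < u x" using ij(2) unfolding U_def by auto
    then show ?thesis using x0(2)[of y] by linarith
  qed
  ultimately obtain A where A: "A \<in> Extr p u" "x0 \<in> A" "A \<subseteq> U - B"
    using min_component_extreme[OF cont U, of C B x0 "u x0"] by blast
  have "A \<subseteq> cell p w" using A(3) cell_child_subset unfolding U_def by blast
  moreover have "vtx p w i \<notin> A" for i using corner[of i] A(3) by blast
  ultimately show ?thesis using A(1,2) by blast
qed

text \<open>Different cells of level \<open>n - 1\<close> meet only in corners, so extreme sets inside them are distinct.\<close>
theorem Extr_lower_bound:
  assumes eq: "equilateral p" and n: "1 \<le> n" "3 < lam n" and nz: "\<exists>i. u (p i) \<noteq> 0"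
  shows "3 ^ (n - 1) \<le> card (Extr p u)"
proof -
  interpret neg: decimation p "\<lambda>x. - u x" lam n by (rule decimation_uminus)
  define W where "W = {w :: 3 list. length w = n - 1}"
  have "\<exists>A\<in>Extr p u. A \<noteq> {} \<and> A \<subseteq> cell p w \<and> (\<forall>i. vtx p w i \<notin> A)" if "w \<in> W" for w
  proof -
    have w: "Suc (length w) = n" using that n(1) by (simp add: W_def)
    obtain i where "D w i \<noteq> 0" using D_nonzero[OF nz] by blast
    then consider "D w i < 0" | "neg.D w i < 0" by (force simp: nder_uminus)
    then show ?thesis
    proof cases
      case 1 then show ?thesis by (rule cell_contains_min[OF eq w n(2)])
    next
      case 2
      then show ?thesis by (rule neg.cell_contains_min[OF eq w n(2), unfolded Extr_uminus])
    qed
  qed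
  then obtain A where A: "\<And>w. w \<in> W \<Longrightarrow> A w \<in> Extr p u" "\<And>w. w \<in> W \<Longrightarrow> A w \<noteq> {}"
    "\<And>w. w \<in> W \<Longrightarrow> A w \<subseteq> cell p w" "\<And>w i. w \<in> W \<Longrightarrow> vtx p w i \<notin> A w"
    by metis
  have "inj_on A W"
  proof (rule inj_onI, rule ccontr)
    fix w v assume wv: "w \<in> W" "v \<in> W" "A w = A v" "w \<noteq> v"
    obtain x where x: "x \<in> A w" using A(2)[OF wv(1)] by blast
    have "\<exists>i. x = vtx p w i"
      by (rule cells_meet[OF eq _ wv(4)]) (use wv x A(3) in \<open>auto simp: W_def\<close>)
    then show False using A(4)[OF wv(1)] x by blast
  qed
  then have "card W \<le> card (Extr p u)"
    by (rule card_inj_on_le) (use A(1) Extr_upper_bound(1)[OF nz] in auto)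
  then show ?thesis by (simp add: W_def card_words)
qed

end

section \<open>The eigenvalue\<close>

lemma phi_root:
  assumes "e \<in> {-1, 1}" "x \<le> 25/4"
  shows "phi e x * (5 - phi e x) = x"
proof -
  define r where "r = sqrt (25 - 4 * x)"
  have r: "r * r = 25 - 4 * x" using assms(2) by (simp add: r_def)
  have "phi e x * (5 - phi e x) = (25 - of_int (e * e) * (r * r)) / 4"
    unfolding phi_def r_def[symmetric] by (simp add: field_simps)
  moreover have "e * e = 1" using assms(1) by auto
  ultimately show ?thesis unfolding r by simp
qed

lemma sqrt_disc_bounds:
  assumes "0 < x" "x < 6"
  shows "1 < sqrt (25 - 4 * x)" "sqrt (25 - 4 * x) < 5"
proof -
  show "1 < sqrt (25 - 4 * x)" using assms by simp
  have "sqrt (25 - 4 * x) < sqrt (5\<^sup>2)" using assms by (intro real_sqrt_less_mono) simp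
  then show "sqrt (25 - 4 * x) < 5" by simp
qed

lemma phi_minus_bounds:
  assumes "0 < x" "x < 6"
  shows "0 < phi (-1) x" "phi (-1) x < 2"
  using sqrt_disc_bounds[OF assms] by (simp_all add: phi_def)

lemma phi_plus_bounds:
  assumes "0 < x" "x < 6"
  shows "3 < phi 1 x" "phi 1 x < 5"
  using sqrt_disc_bounds[OF assms] by (simp_all add: phi_def)

lemma phi_bounds:
  assumes "e \<in> {-1, 1}" "0 < x" "x < 6"
  shows "0 < phi e x" "phi e x < 6"
  using phi_minus_bounds[OF assms(2,3)] phi_plus_bounds[OF assms(2,3)] assms(1) by auto

text \<open>Let \<open>y\<^sub>m\<close> be the \<open>m\<close>-th iterate, so \<open>y\<^sub>m = y\<^sub>m\<^sub>+\<^sub>1 (5 - y\<^sub>m\<^sub>+\<^sub>1)\<close>. Then \<open>5\<^sup>m y\<^sub>m\<close> increases, while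
  \<open>5\<^sup>m y\<^sub>m (1 + y\<^sub>m / 4)\<close> decreases; the constant \<open>1/4\<close> is chosen so that the latter step reduces to
  \<open>(2 - z) (8 - z) \<ge> 0\<close> for \<open>z = y\<^sub>m\<^sub>+\<^sub>1 < 2\<close>.\<close>
lemma psi_bounds:
  assumes "3 < x" "x < 5"
  shows "1 \<le> psi x" "psi x \<le> 17"
proof -
  define y where "y m = (phi (-1) ^^ m) x" for m
  have y_Suc: "y (Suc m) = phi (-1) (y m)" for m by (simp add: y_def)
  have y: "0 < y m \<and> y m < 6" for m
  proof (induction m)
    case 0 show ?case using assms by (simp add: y_def)
  next
    case (Suc m)
    then show ?case unfolding y_Suc using phi_minus_bounds[of "y m"] by auto
  qed
  have y2: "y (Suc m) < 2" for m unfolding y_Suc using phi_minus_bounds(2) y by blast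
  have step: "y m = y (Suc m) * (5 - y (Suc m))" for m
    unfolding y_Suc using phi_root[of "-1" "y m"] y[of m] by simp
  define a where "a m = 5 ^ m * y m" for m
  have "a m \<le> a (Suc m)" for m
  proof -
    have "y m = 5 * y (Suc m) - y (Suc m) * y (Suc m)"
      using step[of m] by (simp add: algebra_simps)
    then have "y m \<le> 5 * y (Suc m)" by simp
    then show ?thesis by (simp add: a_def)
  qed
  then have inc: "incseq a" by (rule incseq_SucI)
  have h: "a m * (1 + y m / 4) \<le> x * (1 + x / 4)" for m
  proof (induction m)
    case 0 show ?case by (simp add: a_def y_def)
  next
    case (Suc m)
    define z where "z = y (Suc m)"
    have z: "0 < z" "z < 2" using y y2 by (simp_all add: z_def)
    have "0 \<le> z\<^sup>2 * ((2 - z) * (8 - z)) / 4" using z by simp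
    also have "\<dots> = z * (5 - z) * (1 + z * (5 - z) / 4) - 5 * z * (1 + z / 4)"
      by (simp add: field_simps power2_eq_square)
    finally have "5 * z * (1 + z / 4) \<le> y m * (1 + y m / 4)"
      using step[of m] by (simp add: z_def)
    then have "5 ^ m * (5 * z * (1 + z / 4)) \<le> 5 ^ m * (y m * (1 + y m / 4))"
      by (intro mult_left_mono) auto
    then have "a (Suc m) * (1 + y (Suc m) / 4) \<le> a m * (1 + y m / 4)"
      by (simp add: a_def z_def mult_ac)
    then show ?case using Suc by linarith
  qed
  have upper: "a m \<le> 45/4" for m
  proof -
    have "0 \<le> a m" using y[of m] by (simp add: a_def)
    then have "a m * 1 \<le> a m * (1 + y m / 4)" using y[of m] by (intro mult_left_mono) auto
    also have "\<dots> \<le> x * (1 + x / 4)" by (rule h)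
    also have "\<dots> \<le> 5 * (1 + 5 / 4)" using assms by (intro mult_mono) auto
    finally show ?thesis by simp
  qed
  obtain L where L: "a \<longlonglongrightarrow> L" using incseq_convergent[OF inc] upper by blast
  have "L \<le> 45/4" by (rule LIMSEQ_le_const2[OF L]) (use upper in auto)
  moreover have "3 \<le> L"
  proof (rule LIMSEQ_le_const[OF L])
    have "3 \<le> a m" for m using incseqD[OF inc, of 0 m] assms by (simp add: a_def y_def)
    then show "\<exists>N. \<forall>m\<ge>N. 3 \<le> a m" by blast
  qed
  moreover have "psi x = 3 / 2 * L" unfolding psi_def using limI[OF L] by (simp add: a_def[abs_def] y_def)
  ultimately show "1 \<le> psi x" "psi x \<le> 17" by auto
qed

lemma phi_word_take: "m \<le> length eps \<Longrightarrow> phi_word (take m eps) l0 = lam_seq l0 eps m"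
proof (induction m)
  case (Suc m) then show ?case by (simp add: phi_word_def take_Suc_conv_app_nth)
qed (simp add: phi_word_def)

lemma eigenvalue_powr:
  assumes "0 < psi (phi_word eps l0)"
  shows "eigenvalue l0 eps powr (d_S / 2)
    = 3 ^ length eps * psi (phi_word eps l0) powr (ln 3 / ln 5)"
proof -
  have "ln (9::real) = ln (3 ^ 2)" by simp
  also have "\<dots> = 2 * ln 3" by (subst ln_realpow) auto
  finally have t: "d_S / 2 = ln 3 / ln 5" by (simp add: d_S_def)
  have "((5::real) ^ length eps) powr (ln 3 / ln 5) = (5 powr (ln 3 / ln 5)) ^ length eps"
    by (simp add: powr_powr mult.commute flip: powr_realpow)
  also have "(5::real) powr (ln 3 / ln 5) = 3" by (simp add: powr_def)
  finally show ?thesis unfolding eigenvalue_def t using assms by (simp add: powr_mult)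
qed

lemma decimation_u_eps:
  assumes l0: "0 < l0" "l0 < 6" and eps: "set eps \<subseteq> {-1, 1}" and u: "is_u_eps p l0 a eps u"
  shows "decimation p u (lam_seq l0 eps) (length eps)"
proof -
  have e: "(if m < length eps then eps ! m else -1) \<in> {-1, 1}" for m
    using subsetD[OF eps nth_mem[of m eps]] by auto
  have rng: "0 < lam_seq l0 eps m \<and> lam_seq l0 eps m < 6" for m
  proof (induction m)
    case (Suc m) then show ?case using phi_bounds[OF e] by simp
  qed (use l0 in simp)
  show ?thesis
  proof
    show "continuous_on (SG p) u" using u unfolding is_u_eps_def by blast
  next
    fix i j k :: 3 and w :: "3 list" assume "i \<noteq> j" "j \<noteq> k" "i \<noteq> k"
    then show "u (vtx p (w @ [i]) j) =
        ((4 - lam_seq l0 eps (Suc (length w))) * (u (vtx p w i) + u (vtx p w j)) + 2 * u (vtx p w k))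
          / ((2 - lam_seq l0 eps (Suc (length w))) * (5 - lam_seq l0 eps (Suc (length w))))"
      using u unfolding is_u_eps_def Let_def vtx_def by simp
  next
    fix m
    show "lam_seq l0 eps (Suc m) * (5 - lam_seq l0 eps (Suc m)) = lam_seq l0 eps m"
      unfolding lam_seq.simps by (rule phi_root[OF e]) (use rng[of m] in simp)
    show "0 < lam_seq l0 eps m" "lam_seq l0 eps m < 6" using rng by auto
    show "lam_seq l0 eps (Suc m) < 2" if "length eps \<le> m"
      using that phi_minus_bounds(2)[of "lam_seq l0 eps m"] rng[of m] by simp
  qed
qed

section \<open>The size of the set of extreme sets\<close>

theorem theorem3p5:
  fixes p :: "3 \<Rightarrow> real^2"
  assumes "equilateral p"
  shows "\<exists>c::real. c > 1 \<and>
    (\<forall>(l0::real) (a::real^3) (n::nat) (eps::int list) (u::real^2 \<Rightarrow> real).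
       0 < l0 \<and> l0 < 6 \<and> a \<noteq> 0 \<and>
       n \<ge> 1 \<and> length eps = n \<and> set eps \<subseteq> {-1, 1} \<and> eps ! (n - 1) = 1 \<and>
       is_u_eps p l0 a eps u \<longrightarrow>
         finite (Extr p u) \<and>
         inverse c * eigenvalue l0 eps powr (d_S / 2) \<le> real (card (Extr p u)) \<and>
         real (card (Extr p u)) \<le> c * eigenvalue l0 eps powr (d_S / 2))"
proof (intro exI[of _ "51::real"] conjI allI impI)
  fix l0 :: real and a :: "real^3" and n :: nat and eps :: "int list" and u :: "real^2 \<Rightarrow> real"
  assume H: "0 < l0 \<and> l0 < 6 \<and> a \<noteq> 0 \<and>
       n \<ge> 1 \<and> length eps = n \<and> set eps \<subseteq> {-1, 1} \<and> eps ! (n - 1) = 1 \<and>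
       is_u_eps p l0 a eps u"
  then have n: "1 \<le> n" and len: "length eps = n" and last: "eps ! (n - 1) = 1" by auto
  have u: "0 < l0" "l0 < 6" "set eps \<subseteq> {-1, 1}" "is_u_eps p l0 a eps u" using H by auto
  interpret decimation p u "lam_seq l0 eps" n
    using decimation_u_eps[OF u] unfolding len .
  have "\<exists>i. a $ i \<noteq> 0" using H by (auto simp: vec_eq_iff)
  then have nz: "\<exists>i. u (p i) \<noteq> 0" using H unfolding is_u_eps_def by metis
  obtain m where m: "n = Suc m" using n by (cases n) auto
  have top: "3 < lam_seq l0 eps n" "lam_seq l0 eps n < 5"
    unfolding m using phi_plus_bounds[OF lam_pos[of m] lam_less[of m]] last len m by simp_all
  have word: "phi_word eps l0 = lam_seq l0 eps n"
    using phi_word_take[of n eps l0] len by simp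
  define q where "q = psi (phi_word eps l0) powr (ln 3 / ln 5)"
  have psi: "1 \<le> psi (phi_word eps l0)" "psi (phi_word eps l0) \<le> 17"
    unfolding word by (rule psi_bounds[OF top])+
  have eig: "eigenvalue l0 eps powr (d_S / 2) = 3 ^ n * q"
    using eigenvalue_powr[of eps l0] psi(1) len by (simp add: q_def)
  have "1 powr (ln 3 / ln 5) \<le> q"
    unfolding q_def using psi(1) by (intro powr_mono2) auto
  then have q1: "1 \<le> q" by simp
  have "q \<le> psi (phi_word eps l0) powr 1"
    unfolding q_def using psi(1) by (intro powr_mono) auto
  then have q17: "q \<le> 17" using psi by simp
  show "finite (Extr p u)" by (rule Extr_upper_bound(1)[OF nz])
  \<comment> \<open>The constant \<open>51 = 3 \<cdot> 17\<close> accounts for the factor \<open>3\<close> between levels \<open>n - 1\<close> and \<open>n\<close> and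
    for the bound \<open>17\<close> on \<open>\<psi>\<close>.\<close>
  have "(3::real) ^ n * q \<le> 3 ^ n * 17" using q17 by (intro mult_left_mono) auto
  also have "\<dots> = 51 * 3 ^ (n - 1)" by (simp add: m)
  also have "\<dots> \<le> 51 * real (card (Extr p u))"
    using of_nat_mono[OF Extr_lower_bound[OF assms n top(1) nz], where 'a = real] by simp
  finally show "inverse 51 * eigenvalue l0 eps powr (d_S / 2) \<le> real (card (Extr p u))"
    unfolding eig by simp
  have "real (card (Extr p u)) \<le> real (4 * 3 ^ n)"
    by (rule of_nat_mono[OF Extr_upper_bound(2)[OF nz]])
  also have "\<dots> \<le> 51 * (3 ^ n * q)"
    using q1 by simp
  finally show "real (card (Extr p u)) \<le> 51 * eigenvalue l0 eps powr (d_S / 2)"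
    unfolding eig .
qed simp

end
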